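(* Let $p\in(0,1)$ be fixed (independent of $n$). For almost all graphs $G$ in the Erdős–Rényi model $G_{n,p}$, the energy of the augmented Zagreb matrix $AZI(G)$ satisfies $$\mathscr{E}(AZI(G))=(1+o(1))\cdot\frac{p^3\sqrt{p(1-p)}}{3\pi}\cdot n^{9/2}.$$
   Context: $G_{n,p}$ is the model of random simple graphs on vertex set $\{1,\dots,n\}$ in which each edge is present independently with probability $p$; $d_i$ is the degree of vertex $i$ in $G=(V,E)$. $AZI(G)$ is the $n\times n$ matrix with $(i,j)$-entry $\left(\frac{d_id_j}{d_i+d_j-2}\right)^3$ if $ij\in E$ and $0$ otherwise (with the entry set to $0$, by convention, if $ij\in E$ and $d_i=d_j=1$, where the formula is undefined). The energy of a real symmetric matrix $A$ with eigenvalues $\lambda_1,\dots,\lambda_n$ is $\mathscr{E}(A)=\sum_{i=1}^n|\lambda_i|$. "Almost all" means with probability tending to $1$ as $n\to\infty$; thus "for almost all graphs, $\mathscr{E}=(1+o(1))g(n)$" means that for every $\varepsilon>0$, $\Pr(|\mathscr{E}/g(n)-1|>\varepsilon)\to0$ as $n\to\infty$. *)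

theory Defs
  imports
    "HOL-Probability.Product_PMF"
    "Jordan_Normal_Form.Char_Poly"
begin

text \<open>A simple graph on the vertex set \<open>{1..n}\<close> is given by its edge set, a set of
  two-element subsets of \<open>{1..n}\<close>.\<close>

definition vertex_pairs :: "nat \<Rightarrow> nat set set" where
  "vertex_pairs n = {e. e \<subseteq> {1..n} \<and> card e = 2}"

definition gnp :: "nat \<Rightarrow> real \<Rightarrow> nat set set pmf" where
  "gnp n p = map_pmf (\<lambda>f. {e \<in> vertex_pairs n. f e})
     (Pi_pmf (vertex_pairs n) False (\<lambda>_. bernoulli_pmf p))"

definition vertex_degree :: "nat set set \<Rightarrow> nat \<Rightarrow> nat" where
  "vertex_degree E i = card {e \<in> E. i \<in> e}"

definition azi_entry :: "nat set set \<Rightarrow> nat \<Rightarrow> nat \<Rightarrow> real" where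
  "azi_entry E i j =
     (if {i, j} \<in> E \<and> \<not> (vertex_degree E i = 1 \<and> vertex_degree E j = 1)
      then (real (vertex_degree E i) * real (vertex_degree E j)
             / (real (vertex_degree E i) + real (vertex_degree E j) - 2)) ^ 3
      else 0)"

text \<open>Matrix indices start at \<open>0\<close>, vertices at \<open>1\<close>. On the diagonal \<open>{i, i} = {i}\<close> is a
  singleton, hence never an edge.\<close>

definition azi_matrix :: "nat \<Rightarrow> nat set set \<Rightarrow> real mat" where
  "azi_matrix n E = mat n n (\<lambda>(i, j). azi_entry E (Suc i) (Suc j))"

text \<open>The multiset \<open>proots (char_poly A)\<close> lists the real eigenvalues of \<open>A\<close> with multiplicity;
  for a real symmetric matrix these are all its eigenvalues.\<close>

definition energy :: "real mat \<Rightarrow> real" where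
  "energy A = (\<Sum>l\<in>#proots (char_poly A). \<bar>l\<bar>)"

end

theory Submission
  imports Defs "Jordan_Normal_Form.Schur_Decomposition"
begin

text \<open>Let \<open>A\<close> be the adjacency matrix, \<open>J\<close> the all-ones matrix, \<open>I\<close> the identity and \<open>s = p (1 - p)\<close>.
  All degrees are close to \<open>n p\<close>, so \<open>d\<^sub>i d\<^sub>j / (d\<^sub>i + d\<^sub>j - 2)\<close> is close to \<open>n p / 2\<close> at an edge, and
  \<open>Y = AZI / ((n p / 2)\<^sup>3 sqrt n)\<close> is close to \<open>A / sqrt n\<close>. Up to the rank-one matrix \<open>p J / sqrt n\<close> and
  a small diagonal, the latter is the Wigner matrix \<open>X = (A - p (J - I)) / sqrt n\<close>, whose entries
  above the diagonal are independent and centred with variance \<open>s / n\<close>. The semicircle law gives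
  \<open>n \<cdot> (8 / (3 \<pi>)) sqrt s\<close> as the asymptotic energy of \<open>Y\<close>; multiplication by
  \<open>(n p / 2)\<^sup>3 sqrt n\<close> produces the claimed constant.

  The argument uses resolvents on the imaginary axis. From
  \<open>\<pi> / 2 \<cdot> \<bar>x\<bar> = \<integral>\<^sub>0\<^sup>\<infinity> x\<^sup>2 / (x\<^sup>2 + t\<^sup>2) dt\<close> one gets Coulson's formula
  \<open>\<pi> / 2 \<cdot> energy M / n = \<integral>\<^sub>0\<^sup>\<infinity> (1 - t Im m(t)) dt\<close>, where \<open>m(t)\<close> is the normalised trace of
  \<open>(M - \<i> t)\<inverse>\<close> (\<open>coulson_integral\<close>). The integrand is bounded by a multiple of \<open>1 / (1 + t\<^sup>2)\<close> as
  soon as the trace of \<open>M\<^sup>2\<close> is \<open>O(n)\<close> (\<open>coulson_bounds\<close>). By dominated convergence it is enough to find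
  the limit of \<open>m(t)\<close> in \<open>L\<^sup>1\<close> for each fixed \<open>t > 0\<close>; convergence of the energy in \<open>L\<^sup>1\<close> follows, and
  Markov's inequality gives the theorem.

  For fixed \<open>t\<close> all resolvents have operator norm at most \<open>1 / t\<close>. Let \<open>G\<close> be the resolvent of \<open>X\<close>,
  \<open>x\<close> its \<open>i\<close>-th row and \<open>H\<close> the resolvent after row and column \<open>i\<close> have been cleared. Then
  \<open>G\<^sub>i\<^sub>i (\<i> t + \<langle>x, H x\<rangle>) = - 1\<close> (\<open>cavity_equation\<close>). Since \<open>H\<close> does not depend on the edges at \<open>i\<close>, the
  form \<open>\<langle>x, H x\<rangle>\<close> is within \<open>O(1 / sqrt n)\<close> of \<open>s / n\<close> times the trace of \<open>H\<close>
  (\<open>quadratic_form_variance\<close>), and this is within \<open>O(1 / sqrt n)\<close> of \<open>s m\<close>. All these estimates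
  hold in mean, with constants depending on \<open>t\<close>. Averaging over \<open>i\<close> yields
  \<open>s m\<^sup>2 + \<i> t m + 1 = O(1 / sqrt n)\<close> in \<open>L\<^sup>1\<close>. The equation is stable in the upper half plane
  (\<open>semicircle_equation_stability\<close>), so \<open>m\<close> is close to \<open>\<i> g\<close> with \<open>s g\<^sup>2 + t g = 1\<close>. The passage from
  \<open>X\<close> to \<open>Y\<close> costs another \<open>O(1 / sqrt n)\<close>: the difference is \<open>p J / sqrt n\<close> plus a matrix of bounded
  expected squared Frobenius norm (\<open>resolvent_trace_perturbation\<close>, \<open>azi_error_frobenius\<close>). Finally
  \<open>\<integral>\<^sub>0\<^sup>\<infinity> (1 - t g) dt = 4 / 3 \<cdot> sqrt s\<close> (\<open>semicircle_integral\<close>).\<close>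

section \<open>Resolvents of symmetric matrices on the imaginary axis\<close>

definition sym_on :: "nat \<Rightarrow> (nat \<Rightarrow> nat \<Rightarrow> real) \<Rightarrow> bool" where
  "sym_on n M \<longleftrightarrow> (\<forall>i<n. \<forall>j<n. M i j = M j i)"

text \<open>The functions \<open>G\<close> with \<open>(M - \<i> t) G = G (M - \<i> t) = I\<close>, for matrices given by their
  entries with indices below \<open>n\<close>. Only spectral parameters on the imaginary axis occur: they suffice
  for the energy, and there \<open>1 / t\<close> bounds the operator norm whatever \<open>M\<close> is.\<close>

definition is_resolvent ::
    "nat \<Rightarrow> (nat \<Rightarrow> nat \<Rightarrow> real) \<Rightarrow> real \<Rightarrow> (nat \<Rightarrow> nat \<Rightarrow> complex) \<Rightarrow> bool" where
  "is_resolvent n M t G \<longleftrightarrow> (\<forall>i<n. \<forall>j<n.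
     (\<Sum>k<n. of_real (M i k) * G k j) - \<i> * of_real t * G i j = (if i = j then 1 else 0) \<and>
     (\<Sum>k<n. G i k * of_real (M k j)) - \<i> * of_real t * G i j = (if i = j then 1 else 0))"

definition resolvent ::
    "nat \<Rightarrow> (nat \<Rightarrow> nat \<Rightarrow> real) \<Rightarrow> real \<Rightarrow> nat \<Rightarrow> nat \<Rightarrow> complex" where
  "resolvent n M t = (SOME G. is_resolvent n M t G)"

abbreviation vnorm :: "nat \<Rightarrow> (nat \<Rightarrow> complex) \<Rightarrow> real" where
  "vnorm n v \<equiv> L2_set (\<lambda>i. cmod (v i)) {..<n}"

text \<open>The quadratic form of a symmetric real matrix takes real values, so the imaginary part of
  \<open>\<langle>u, (M - \<i> t) u\<rangle>\<close> is exactly \<open>- t \<parallel>u\<parallel>\<^sup>2\<close>; Cauchy-Schwarz bounds it by \<open>\<parallel>u\<parallel> \<parallel>v\<parallel>\<close>. Existence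
  and all norm bounds of the resolvent follow from this inequality.\<close>

lemma shifted_lower_bound:
  assumes "sym_on n M" "t > 0"
    and eq: "\<And>i. i < n \<Longrightarrow> (\<Sum>k<n. of_real (M i k) * u k) - \<i> * of_real t * u i = v i"
  shows "t * vnorm n u \<le> vnorm n v"
proof -
  define Q where "Q = (\<Sum>i<n. \<Sum>k<n. cnj (u i) * of_real (M i k) * u k)"
  have "cnj Q = (\<Sum>i<n. \<Sum>k<n. u i * of_real (M i k) * cnj (u k))"
    by (simp add: Q_def)
  also have "\<dots> = (\<Sum>k<n. \<Sum>i<n. u i * of_real (M i k) * cnj (u k))"
    by (rule sum.swap)
  also have "\<dots> = Q"
    unfolding Q_def using assms(1) by (intro sum.cong refl) (auto simp: sym_on_def)
  finally have "Im Q = 0" by (metis Im_complex_of_real Reals_cnj_iff complex_is_Real_iff)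
  have vn2: "(vnorm n u)\<^sup>2 = (\<Sum>i<n. (cmod (u i))\<^sup>2)"
    by (simp add: L2_set_def sum_nonneg)
  have "(\<Sum>i<n. cnj (u i) * v i)
      = (\<Sum>i<n. (\<Sum>k<n. cnj (u i) * of_real (M i k) * u k) - \<i> * of_real t * (u i * cnj (u i)))"
    by (intro sum.cong refl) (simp add: eq [symmetric] algebra_simps sum_distrib_left)
  also have "\<dots> = Q - \<i> * of_real t * (\<Sum>i<n. u i * cnj (u i))"
    by (simp add: Q_def sum_subtractf sum_distrib_left)
  also have "(\<Sum>i<n. u i * cnj (u i)) = of_real ((vnorm n u)\<^sup>2)"
    by (simp add: vn2 complex_norm_square [symmetric])
  finally have S: "Im (\<Sum>i<n. cnj (u i) * v i) = - t * (vnorm n u)\<^sup>2"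
    using \<open>Im Q = 0\<close> by simp
  have "t * (vnorm n u)\<^sup>2 \<le> cmod (\<Sum>i<n. cnj (u i) * v i)"
    using abs_Im_le_cmod [of "\<Sum>i<n. cnj (u i) * v i"] S by simp
  also have "\<dots> \<le> (\<Sum>i<n. \<bar>cmod (u i)\<bar> * \<bar>cmod (v i)\<bar>)"
    by (rule order_trans [OF norm_sum]) (simp add: norm_mult)
  also have "\<dots> \<le> vnorm n u * vnorm n v"
    by (rule L2_set_mult_ineq)
  finally have "vnorm n u * (t * vnorm n u) \<le> vnorm n u * vnorm n v"
    by (simp add: power2_eq_square algebra_simps)
  then show ?thesis
    by (cases "vnorm n u = 0") (auto simp: L2_set_nonneg less_le)
qed

lemma resolvent_exists:
  assumes "sym_on n M" "t > 0"
  shows "\<exists>G. is_resolvent n M t G"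
proof -
  define C where "C = Matrix.mat n n (\<lambda>(i,j). complex_of_real (M i j) - (if i = j then \<i> * of_real t else 0))"
  have C: "C \<in> carrier_mat n n" by (simp add: C_def)
  have "Determinant.det C \<noteq> 0"
  proof
    assume "Determinant.det C = 0"
    then obtain w where w: "w \<in> carrier_vec n" "w \<noteq> 0\<^sub>v n" "C *\<^sub>v w = 0\<^sub>v n"
      using det_0_iff_vec_prod_zero_field [OF C] by auto
    define u where "u i = vec_index w i" for i
    have "(\<Sum>k<n. of_real (M i k) * u k) - \<i> * of_real t * u i = 0" if "i < n" for i
    proof -
      have "vec_index (C *\<^sub>v w) i = 0" using w that by simp
      moreover have "vec_index (C *\<^sub>v w) i = (\<Sum>k<n. (of_real (M i k) - (if i = k then \<i> * of_real t else 0)) * u k)"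
        using w(1) that by (auto simp: C_def mult_mat_vec_def scalar_prod_def u_def lessThan_atLeast0)
      ultimately show ?thesis
        using that by (simp add: algebra_simps sum_subtractf if_distrib [of "\<lambda>x. _ * x"] sum.delta' cong: if_cong)
    qed
    from shifted_lower_bound [OF assms this] have "vnorm n u \<le> 0"
      using assms(2) by (auto simp: L2_set_def mult_le_0_iff)
    then have "vnorm n u = 0" by (simp add: L2_set_nonneg antisym)
    then have "\<forall>i<n. u i = 0"
      by (subst (asm) L2_set_eq_0_iff) auto
    then have "w = 0\<^sub>v n" using w by (intro eq_vecI) (auto simp: u_def)
    with w show False by simp
  qed
  from det_non_zero_imp_unit [OF C this, of "()"]
  obtain B where B: "B \<in> carrier_mat n n" "B * C = 1\<^sub>m n" "C * B = 1\<^sub>m n"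
    by (auto simp: Units_def ring_mat_def)
  have "(C * B) $$ (i,j) = (\<Sum>k<n. of_real (M i k) * B $$ (k,j)) - \<i> * of_real t * B $$ (i,j)"
    "(B * C) $$ (i,j) = (\<Sum>k<n. B $$ (i,k) * of_real (M k j)) - \<i> * of_real t * B $$ (i,j)"
    if "i < n" "j < n" for i j
    using that B(1) by (auto simp: C_def scalar_prod_def lessThan_atLeast0 algebra_simps sum_subtractf
        if_distrib [of "\<lambda>x. _ * x"] sum.delta sum.delta' cong: if_cong)
  then have "is_resolvent n M t (\<lambda>i j. B $$ (i,j))"
    unfolding is_resolvent_def using B(2,3) by auto
  then show ?thesis by blast
qed

lemma resolventD:
  assumes "sym_on n M" "t > 0"
  shows "is_resolvent n M t (resolvent n M t)"
  unfolding resolvent_def using resolvent_exists [OF assms] by (rule someI_ex)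

lemma resolvent_left:
  assumes "sym_on n M" "t > 0" "i < n" "j < n"
  shows "(\<Sum>k<n. of_real (M i k) * resolvent n M t k j) - \<i> * of_real t * resolvent n M t i j
           = (if i = j then 1 else 0)"
  using resolventD [OF assms(1,2)] assms(3,4) unfolding is_resolvent_def by blast

lemma resolvent_right:
  assumes "sym_on n M" "t > 0" "i < n" "j < n"
  shows "(\<Sum>k<n. resolvent n M t i k * of_real (M k j)) - \<i> * of_real t * resolvent n M t i j
           = (if i = j then 1 else 0)"
  using resolventD [OF assms(1,2)] assms(3,4) unfolding is_resolvent_def by blast

lemma resolvent_solves:
  assumes "sym_on n M" "t > 0" "i < n"
  shows "(\<Sum>k<n. of_real (M i k) * (\<Sum>j<n. resolvent n M t k j * v j))
           - \<i> * of_real t * (\<Sum>j<n. resolvent n M t i j * v j) = v i"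
proof -
  let ?G = "resolvent n M t"
  have "(\<Sum>k<n. of_real (M i k) * (\<Sum>j<n. ?G k j * v j)) = (\<Sum>k<n. \<Sum>j<n. of_real (M i k) * ?G k j * v j)"
    by (simp add: sum_distrib_left mult.assoc)
  also have "\<dots> = (\<Sum>j<n. (\<Sum>k<n. of_real (M i k) * ?G k j) * v j)"
    by (subst sum.swap) (simp add: sum_distrib_right)
  finally have "(\<Sum>k<n. of_real (M i k) * (\<Sum>j<n. ?G k j * v j)) - \<i> * of_real t * (\<Sum>j<n. ?G i j * v j)
     = (\<Sum>j<n. ((\<Sum>k<n. of_real (M i k) * ?G k j) - \<i> * of_real t * ?G i j) * v j)"
    by (simp add: sum_distrib_left sum_subtractf algebra_simps)
  also have "\<dots> = (\<Sum>j<n. (if i = j then 1 else 0) * v j)"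
    using resolvent_left [OF assms] by (intro sum.cong refl) auto
  also have "\<dots> = v i" using assms(3) by (simp add: if_distrib [of "\<lambda>x. x * _"] cong: if_cong)
  finally show ?thesis .
qed

text \<open>The operator norm of the resolvent is at most \<open>1 / t\<close>.\<close>

lemma resolvent_bound:
  assumes "sym_on n M" "t > 0"
  shows "vnorm n (\<lambda>i. \<Sum>j<n. resolvent n M t i j * v j) \<le> vnorm n v / t"
proof -
  have "t * vnorm n (\<lambda>i. \<Sum>j<n. resolvent n M t i j * v j) \<le> vnorm n v"
    by (rule shifted_lower_bound [OF assms]) (rule resolvent_solves [OF assms])
  then show ?thesis using assms(2) by (simp add: field_simps)
qed

lemma resolvent_column_bound:
  assumes "sym_on n M" "t > 0" "j < n"
  shows "vnorm n (\<lambda>i. resolvent n M t i j) \<le> 1 / t"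
proof -
  have "vnorm n (\<lambda>i. resolvent n M t i j)
      = vnorm n (\<lambda>i. \<Sum>k<n. resolvent n M t i k * (if k = j then 1 else 0))"
    using assms(3) by (simp add: if_distrib [of "\<lambda>x. _ * x"] cong: if_cong)
  also have "\<dots> \<le> vnorm n (\<lambda>k. if k = j then 1 else 0) / t"
    by (rule resolvent_bound [OF assms(1,2)])
  also have "vnorm n (\<lambda>k. if k = j then 1 else 0) = 1"
    using assms(3) by (simp add: L2_set_def if_distrib [of "\<lambda>x. cmod x"] if_distrib [of "\<lambda>x. x\<^sup>2"] cong: if_cong)
  finally show ?thesis .
qed

lemma resolvent_entry_bound:
  assumes "sym_on n M" "t > 0" "i < n" "j < n"
  shows "cmod (resolvent n M t i j) \<le> 1 / t"
  using member_le_L2_set [of "{..<n}" i "\<lambda>i. cmod (resolvent n M t i j)"]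
    resolvent_column_bound [OF assms(1,2,4)] assms(3) by auto

text \<open>Every column has Euclidean norm at most \<open>1 / t\<close>. Compared with the trivial bound
  \<open>n\<^sup>2 / t\<^sup>2\<close> this saves a factor \<open>n\<close>, which is what makes quadratic forms in independent entries
  concentrate.\<close>

lemma resolvent_frobenius:
  assumes "sym_on n M" "t > 0"
  shows "(\<Sum>i<n. \<Sum>j<n. (cmod (resolvent n M t i j))\<^sup>2) \<le> n / t\<^sup>2"
proof -
  have "(\<Sum>i<n. \<Sum>j<n. (cmod (resolvent n M t i j))\<^sup>2) = (\<Sum>j<n. (vnorm n (\<lambda>i. resolvent n M t i j))\<^sup>2)"
    by (subst sum.swap) (simp add: L2_set_def sum_nonneg)
  also have "\<dots> \<le> (\<Sum>j<n. (1/t)\<^sup>2)"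
    by (intro sum_mono power_mono resolvent_column_bound assms) (auto simp: L2_set_nonneg)
  finally show ?thesis by (simp add: power_divide)
qed

section \<open>Spectrum and traces\<close>

lemma trace_mult_commute:
  assumes "X \<in> carrier_mat n n" "Y \<in> carrier_mat n n"
  shows "(\<Sum>i<n. (X * Y) $$ (i,i)) = (\<Sum>i<n. (Y * X) $$ (i,i) :: 'a :: comm_semiring_0)"
proof -
  have "(\<Sum>i<n. (X * Y) $$ (i,i)) = (\<Sum>i<n. \<Sum>k<n. X $$ (i,k) * Y $$ (k,i))"
    using assms by (auto simp: scalar_prod_def lessThan_atLeast0 intro!: sum.cong)
  also have "\<dots> = (\<Sum>k<n. \<Sum>i<n. X $$ (i,k) * Y $$ (k,i))"
    by (rule sum.swap)
  also have "\<dots> = (\<Sum>i<n. (Y * X) $$ (i,i))"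
    using assms by (auto simp: scalar_prod_def lessThan_atLeast0 mult.commute intro!: sum.cong)
  finally show ?thesis .
qed

text \<open>The inverse of an upper triangular matrix is upper triangular, so the diagonal entries
  of \<open>D E = I\<close> decouple. Working upwards from the last row shows that the entries of \<open>E\<close> below
  the diagonal vanish.\<close>

lemma upper_triangular_inverse_diagonal:
  fixes D :: "'a :: field mat"
  assumes D: "D \<in> carrier_mat n n" "upper_triangular D" and E: "E \<in> carrier_mat n n"
    and DE: "D * E = 1\<^sub>m n" and nz: "\<And>i. i < n \<Longrightarrow> D $$ (i,i) \<noteq> 0" and i: "i < n"
  shows "E $$ (i,i) = 1 / D $$ (i,i)"
proof -
  \<comment> \<open>If column \<open>j\<close> of \<open>E\<close> vanishes below row \<open>i\<close>, the entry of \<open>D E\<close> at \<open>(i, j)\<close> has a single nonzero term.\<close>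
  have tail: "D $$ (i,i) * E $$ (i,j) = (if i = j then 1 else 0)"
    if "i < n" "j < n" and above: "\<And>k. i < k \<Longrightarrow> k < n \<Longrightarrow> E $$ (k,j) = 0" for i j
  proof -
    have "(if i = j then 1 else 0) = (D * E) $$ (i,j)" using DE that by simp
    also have "\<dots> = (\<Sum>k<n. D $$ (i,k) * E $$ (k,j))"
      using D E that by (auto simp: scalar_prod_def lessThan_atLeast0)
    also have "\<dots> = (\<Sum>k<n. if k = i then D $$ (i,i) * E $$ (i,j) else 0)"
    proof (intro sum.cong refl)
      fix k assume "k \<in> {..<n}"
      moreover have "D $$ (i,k) = 0" if "k < i"
        using D \<open>i < n\<close> that by (auto simp: upper_triangular_def)
      ultimately show "D $$ (i,k) * E $$ (k,j) = (if k = i then D $$ (i,i) * E $$ (i,j) else 0)"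
        using above [of k] by (cases k i rule: linorder_cases) auto
    qed
    finally show ?thesis using that by simp
  qed
  have zero: "E $$ (k,j) = 0" if "j < k" "k < n" for j k
    using that
  proof (induction "n - k" arbitrary: k rule: less_induct)
    case less
    have "D $$ (k,k) * E $$ (k,j) = 0"
      using tail [of k j] less by auto
    with nz less.prems show ?case by simp
  qed
  have "D $$ (i,i) * E $$ (i,i) = 1"
    using tail [of i i] zero i by auto
  with nz [OF i] show ?thesis by (simp add: field_simps)
qed

text \<open>If \<open>a\<close> had a nonzero imaginary part, its eigenvector would lie in the kernel of
  \<open>\<sigma> (M - Re a) - \<i> \<bar>Im a\<bar>\<close> with \<open>\<sigma> = sgn (Im a)\<close>, a matrix of the kind treated in
  \<open>shifted_lower_bound\<close>.\<close>

lemma symmetric_eigenvalue_real: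
  assumes sym: "sym_on n M"
    and eig: "\<And>i. i < n \<Longrightarrow> (\<Sum>k<n. of_real (M i k) * u k) = a * u i"
    and nz: "i < n" "u i \<noteq> 0"
  shows "Im a = 0"
proof (rule ccontr)
  assume "Im a \<noteq> 0"
  define \<sigma> where "\<sigma> = sgn (Im a)"
  have \<sigma>: "\<sigma> * Im a > 0" using \<open>Im a \<noteq> 0\<close> by (auto simp: \<sigma>_def sgn_if)
  define N where "N i k = \<sigma> * (M i k - (if i = k then Re a else 0))" for i k
  have "sym_on n N" using sym by (auto simp: sym_on_def N_def)
  moreover have "(\<Sum>k<n. of_real (N i k) * u k) - \<i> * of_real (\<sigma> * Im a) * u i = 0" if "i < n" for i
  proof -
    have "(\<Sum>k<n. of_real (N i k) * u k)
        = of_real \<sigma> * ((\<Sum>k<n. of_real (M i k) * u k) - (\<Sum>k<n. if k = i then of_real (Re a) * u k else 0))"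
      unfolding sum_subtractf [symmetric] sum_distrib_left
      by (intro sum.cong refl) (auto simp: N_def algebra_simps)
    also have "\<dots> = of_real \<sigma> * (a - of_real (Re a)) * u i"
      using eig [OF that] that by (simp add: algebra_simps)
    also have "a - of_real (Re a) = \<i> * of_real (Im a)"
      by (simp add: complex_eq_iff)
    finally show ?thesis by simp
  qed
  ultimately have "\<sigma> * Im a * vnorm n u \<le> vnorm n (\<lambda>_. 0)"
    by (rule shifted_lower_bound [OF _ \<sigma>])
  then have "\<sigma> * Im a * vnorm n u \<le> 0" by (simp add: L2_set_def)
  with \<sigma> have "vnorm n u \<le> 0" by (metis linorder_not_le mult_pos_pos)
  then have "vnorm n u = 0" by (simp add: L2_set_nonneg antisym)
  with nz show False by (subst (asm) L2_set_eq_0_iff) auto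
qed

text \<open>A complex Schur triangularisation expresses traces by eigenvalues. The characteristic polynomial splits over the reals
  because all its complex roots are real, and conjugation to triangular form turns the traces of
  \<open>M\<^sup>2\<close> and of the resolvent into sums over the diagonal. The scaling factor \<open>c\<close> is included because
  the matrix of interest is a multiple of the one whose energy is wanted.\<close>

lemma symmetric_spectrum:
  assumes sym: "sym_on n M"
  obtains es :: "real list" where
    "proots (char_poly (Matrix.mat n n (\<lambda>(i,j). M i j))) = mset es"
    "length es = n"
    "(\<Sum>e\<leftarrow>es. e\<^sup>2) = (\<Sum>i<n. \<Sum>j<n. (M i j)\<^sup>2)"
    "\<forall>c. \<forall>t>0. (\<Sum>i<n. resolvent n (\<lambda>i j. c * M i j) t i i)
             = (\<Sum>e\<leftarrow>es. 1 / (of_real (c * e) - \<i> * of_real t))"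
proof -
  define A where "A = Matrix.mat n n (\<lambda>(i,j). M i j)"
  define Ac where "Ac = map_mat complex_of_real A"
  have A: "A \<in> carrier_mat n n" and Ac: "Ac \<in> carrier_mat n n" by (auto simp: A_def Ac_def)
  have Ac_nth: "Ac $$ (i,j) = of_real (M i j)" if "i < n" "j < n" for i j
    using that by (simp add: Ac_def A_def)
  obtain as where as: "char_poly Ac = (\<Prod>a\<leftarrow>as. [:- a, 1:])" "length as = n"
    using char_poly_factorized [OF Ac] by blast
  have real: "Im a = 0" if "a \<in> set as" for a
  proof -
    have "poly (char_poly Ac) a = 0"
      using that by (simp add: as poly_prod_list prod_list_zero_iff image_iff)
    then have "eigenvalue Ac a" using eigenvalue_root_char_poly [OF Ac] by simp
    then obtain v where v: "v \<in> carrier_vec n" "v \<noteq> 0\<^sub>v n" "Ac *\<^sub>v v = a \<cdot>\<^sub>v v"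
      using Ac by (auto simp: eigenvalue_def eigenvector_def)
    from v(1,2) obtain i where i: "i < n" "vec_index v i \<noteq> 0"
      by (metis eq_vecI carrier_vecD index_zero_vec(1,2))
    have "(\<Sum>k<n. of_real (M i k) * vec_index v k) = a * vec_index v i" if "i < n" for i
    proof -
      have "vec_index (Ac *\<^sub>v v) i = (\<Sum>k<n. of_real (M i k) * vec_index v k)"
        using v(1) that Ac by (auto simp: scalar_prod_def lessThan_atLeast0 Ac_nth)
      with v that show ?thesis by simp
    qed
    from symmetric_eigenvalue_real [OF sym this i] show ?thesis by simp
  qed
  define es where "es = map Re as"
  have as_es: "as = map complex_of_real es"
    using real by (auto simp: es_def o_def map_idI complex_eq_iff intro!: map_idI [symmetric])
  have len: "length es = n" using as by (simp add: es_def)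
  have "map_poly complex_of_real (char_poly A) = char_poly Ac"
    unfolding Ac_def by (rule of_real_hom.char_poly_hom [OF A, symmetric])
  also have "\<dots> = map_poly complex_of_real (\<Prod>e\<leftarrow>es. [:- e, 1:])"
  proof -
    interpret of_real_poly: map_poly_inj_idom_hom complex_of_real ..
    show ?thesis
      unfolding as as_es by (simp add: of_real_poly.hom_prod_list o_def hom_distribs)
  qed
  finally have cp: "char_poly A = (\<Prod>e\<leftarrow>es. [:- e, 1:])"
    by (simp add: poly_eq_iff coeff_map_poly)
  have pr: "proots (char_poly A) = mset es"
  proof -
    have "proots (\<Prod>e\<leftarrow>es. [:- e, 1:]) = mset es" for es :: "real list"
    proof (induction es)
      case (Cons e es)
      have "(\<Prod>e\<leftarrow>es. [:- e, 1:]) \<noteq> 0" by (auto simp: prod_list_zero_iff)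
      then have "proots ([:- e, 1:] * (\<Prod>e\<leftarrow>es. [:- e, 1:]))
          = proots [:- e, 1:] + proots (\<Prod>e\<leftarrow>es. [:- e, 1:])"
        by (intro proots_mult) auto
      then show ?case using Cons by (simp del: mult_pCons_left)
    qed auto
    then show ?thesis by (simp add: cp)
  qed
  obtain B P Q where BPQ: "schur_decomposition Ac as = (B,P,Q)"
    by (cases "schur_decomposition Ac as")
  from schur_decomposition [OF Ac as(1) BPQ]
  have sim: "similar_mat_wit Ac B P Q" and ut: "upper_triangular B" and dB: "diag_mat B = as" by auto
  from similar_mat_witD2 [OF Ac sim]
  have B: "B \<in> carrier_mat n n" and P: "P \<in> carrier_mat n n" and Q: "Q \<in> carrier_mat n n"
    and PQ: "P * Q = 1\<^sub>m n" and QP: "Q * P = 1\<^sub>m n" and AcB: "Ac = P * B * Q" by auto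
  have Bii: "B $$ (i,i) = of_real (es ! i)" if "i < n" for i
  proof -
    have "B $$ (i,i) = as ! i" using B that by (auto simp: dB [symmetric] diag_mat_def)
    then show ?thesis using that len by (simp add: as_es)
  qed
  have sum_es: "(\<Sum>e\<leftarrow>es. f e) = (\<Sum>i<n. f (es ! i))" for f :: "real \<Rightarrow> 'b :: comm_monoid_add"
    by (simp add: sum_list_sum_nth len lessThan_atLeast0)
  have conj: "(\<Sum>i<n. (P * X * Q) $$ (i,i)) = (\<Sum>i<n. X $$ (i,i))" if X: "X \<in> carrier_mat n n" for X
  proof -
    have "(\<Sum>i<n. (P * X * Q) $$ (i,i)) = (\<Sum>i<n. (Q * (P * X)) $$ (i,i))"
      by (rule trace_mult_commute) (use P Q X in auto)
    also have "Q * (P * X) = X"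
      using P Q X QP by (simp flip: assoc_mult_mat [of Q n n P n X n])
    finally show ?thesis .
  qed
  have sq: "(\<Sum>e\<leftarrow>es. e\<^sup>2) = (\<Sum>i<n. \<Sum>j<n. (M i j)\<^sup>2)"
  proof -
    have "complex_of_real (\<Sum>i<n. \<Sum>j<n. (M i j)\<^sup>2) = (\<Sum>i<n. \<Sum>j<n. Ac $$ (i,j) * Ac $$ (j,i))"
      using sym by (auto simp: Ac_nth sym_on_def power2_eq_square intro!: sum.cong)
    also have "\<dots> = (\<Sum>i<n. (Ac * Ac) $$ (i,i))"
      using Ac by (auto simp: scalar_prod_def lessThan_atLeast0)
    also have "Ac * Ac = P * (B * B) * Q"
    proof -
      have "Ac * Ac = P * B * (Q * (P * B * Q))"
        unfolding AcB using P Q B by (intro assoc_mult_mat) auto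
      also have "Q * (P * B * Q) = B * Q"
      proof -
        have "Q * (P * B * Q) = Q * (P * (B * Q))" using P Q B by (simp add: assoc_mult_mat [of P n n B n Q n])
        also have "\<dots> = (Q * P) * (B * Q)" using P Q B by (intro assoc_mult_mat [symmetric]) auto
        finally show ?thesis using QP B Q by simp
      qed
      also have "P * B * (B * Q) = P * (B * (B * Q))" using P Q B by (intro assoc_mult_mat) auto
      also have "B * (B * Q) = B * B * Q" using Q B by (intro assoc_mult_mat [symmetric]) auto
      also have "P * (B * B * Q) = P * (B * B) * Q" using P Q B by (intro assoc_mult_mat [symmetric]) auto
      finally show ?thesis .
    qed
    also have "(\<Sum>i<n. (P * (B * B) * Q) $$ (i,i)) = (\<Sum>i<n. (B * B) $$ (i,i))"
      by (rule conj) (use B in auto)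
    also have "\<dots> = (\<Sum>i<n. \<Sum>k<n. B $$ (i,k) * B $$ (k,i))"
      using B by (auto simp: scalar_prod_def lessThan_atLeast0)
    also have "\<dots> = (\<Sum>i<n. \<Sum>k<n. if k = i then (B $$ (i,i))\<^sup>2 else 0)"
    proof (intro sum.cong refl)
      fix i k assume "i \<in> {..<n}" "k \<in> {..<n}"
      then show "B $$ (i,k) * B $$ (k,i) = (if k = i then (B $$ (i,i))\<^sup>2 else 0)"
        using ut B by (cases i k rule: linorder_cases) (auto simp: upper_triangular_def power2_eq_square)
    qed
    also have "\<dots> = (\<Sum>i<n. of_real ((es ! i)\<^sup>2))"
      by (auto simp: Bii intro!: sum.cong)
    also have "\<dots> = of_real (\<Sum>e\<leftarrow>es. e\<^sup>2)"
      by (simp add: sum_es)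
    finally show ?thesis by (simp only: of_real_eq_iff)
  qed
  have tr: "(\<Sum>i<n. resolvent n (\<lambda>i j. c * M i j) t i i)
             = (\<Sum>e\<leftarrow>es. 1 / (of_real (c * e) - \<i> * of_real t))" if t: "t > 0" for c t
  proof -
    define G where "G = Matrix.mat n n (\<lambda>(i,j). resolvent n (\<lambda>i j. c * M i j) t i j)"
    define w where "w = \<i> * complex_of_real t"
    define D where "D = of_real c \<cdot>\<^sub>m B + (- w) \<cdot>\<^sub>m 1\<^sub>m n"
    have G: "G \<in> carrier_mat n n" and D: "D \<in> carrier_mat n n"
      using B by (auto simp: G_def D_def)
    have symc: "sym_on n (\<lambda>i j. c * M i j)" using sym by (auto simp: sym_on_def)
    have "G * (of_real c \<cdot>\<^sub>m Ac + (- w) \<cdot>\<^sub>m 1\<^sub>m n) = 1\<^sub>m n"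
    proof (rule eq_matI)
      fix i j assume "i < dim_row (1\<^sub>m n :: complex mat)" "j < dim_col (1\<^sub>m n :: complex mat)"
      then have ij: "i < n" "j < n" by auto
      have "(G * (of_real c \<cdot>\<^sub>m Ac + (- w) \<cdot>\<^sub>m 1\<^sub>m n)) $$ (i,j)
          = (\<Sum>k<n. G $$ (i,k) * (of_real c * of_real (M k j) + (- w) * (if k = j then 1 else 0)))"
        using ij G Ac by (auto simp: scalar_prod_def lessThan_atLeast0 Ac_nth intro!: sum.cong)
      also have "\<dots> = (\<Sum>k<n. G $$ (i,k) * of_real (c * M k j)) - (\<Sum>k<n. if k = j then w * G $$ (i,k) else 0)"
        unfolding sum_subtractf [symmetric] by (intro sum.cong refl) (auto simp: algebra_simps)
      also have "\<dots> = (if i = j then 1 else 0)"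
        using resolvent_right [OF symc t ij] ij by (simp add: G_def w_def)
      finally show "(G * (of_real c \<cdot>\<^sub>m Ac + (- w) \<cdot>\<^sub>m 1\<^sub>m n)) $$ (i,j) = 1\<^sub>m n $$ (i,j)"
        using ij by simp
    qed (use G Ac in auto)
    also have "of_real c \<cdot>\<^sub>m Ac + (- w) \<cdot>\<^sub>m 1\<^sub>m n = P * D * Q"
    proof -
      have "P * D * Q = (P * (of_real c \<cdot>\<^sub>m B) + P * ((- w) \<cdot>\<^sub>m 1\<^sub>m n)) * Q"
        unfolding D_def using P B by (subst mult_add_distrib_mat) auto
      also have "\<dots> = P * (of_real c \<cdot>\<^sub>m B) * Q + P * ((- w) \<cdot>\<^sub>m 1\<^sub>m n) * Q"
        using P B Q by (intro add_mult_distrib_mat) auto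
      also have "P * ((- w) \<cdot>\<^sub>m 1\<^sub>m n) * Q = (- w) \<cdot>\<^sub>m 1\<^sub>m n"
        using P Q by (simp add: mult_smult_distrib [of P n n _ n] mult_smult_assoc_mat [of P n n Q n] PQ)
      also have "P * (of_real c \<cdot>\<^sub>m B) * Q = of_real c \<cdot>\<^sub>m Ac"
        using P B Q by (simp add: AcB mult_smult_distrib [of P n n _ n] mult_smult_assoc_mat [of "P * B" n n Q n])
      finally show ?thesis by simp
    qed
    finally have GD: "G * (P * D * Q) = 1\<^sub>m n" .
    define E where "E = Q * G * P"
    have E: "E \<in> carrier_mat n n" using P Q G by (simp add: E_def)
    have "E * D = 1\<^sub>m n"
    proof -
      have "E * D = E * D * (Q * P)" using E D QP by simp
      also have "\<dots> = E * D * Q * P" using E D Q P by (intro assoc_mult_mat [symmetric]) auto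
      also have "E * D * Q = Q * (G * (P * D * Q))"
        unfolding E_def using P Q G D
        by (simp add: assoc_mult_mat [of _ n n _ n _ n])
      finally show ?thesis using GD Q P QP by simp
    qed
    then have DE: "D * E = 1\<^sub>m n"
      by (rule mat_mult_left_right_inverse [OF E D])
    have Dii: "D $$ (i,i) = of_real (c * es ! i) - w" if "i < n" for i
      using that B by (simp add: D_def Bii)
    have Dnz: "D $$ (i,i) \<noteq> 0" if "i < n" for i
      using t that by (auto simp: Dii w_def complex_eq_iff)
    have "upper_triangular D"
      using ut B by (auto simp: upper_triangular_def D_def)
    have "(\<Sum>i<n. resolvent n (\<lambda>i j. c * M i j) t i i) = (\<Sum>i<n. G $$ (i,i))"
      by (simp add: G_def)
    also have "\<dots> = (\<Sum>i<n. (P * E * Q) $$ (i,i))"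
    proof -
      have "P * E * Q = G"
      proof -
        have "P * E * Q = (P * Q) * (G * (P * Q))"
          unfolding E_def using P Q G by (simp add: assoc_mult_mat [of _ n n _ n _ n])
        then show ?thesis using G PQ by simp
      qed
      then show ?thesis by simp
    qed
    also have "\<dots> = (\<Sum>i<n. E $$ (i,i))" by (rule conj [OF E])
    also have "\<dots> = (\<Sum>i<n. 1 / (of_real (c * es ! i) - w))"
      using upper_triangular_inverse_diagonal [OF D \<open>upper_triangular D\<close> E DE Dnz]
      by (intro sum.cong refl) (simp add: Dii)
    also have "\<dots> = (\<Sum>e\<leftarrow>es. 1 / (of_real (c * e) - w))"
      by (simp add: sum_es)
    finally show ?thesis by (simp add: w_def)
  qed
  show thesis
    by (rule that [OF pr [unfolded A_def] len sq]) (use tr in blast)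
qed

section \<open>Perturbation and cavity equations\<close>

text \<open>The resolvent identity \<open>G - H = H (N - M) G\<close>.\<close>

lemma resolvent_difference:
  assumes M: "sym_on n M" and N: "sym_on n N" and t: "t > 0" and i: "i < n" and j: "j < n"
  shows "resolvent n M t i j - resolvent n N t i j
    = (\<Sum>k<n. \<Sum>l<n. resolvent n N t i k * of_real (N k l - M k l) * resolvent n M t l j)"
proof -
  let ?G = "resolvent n M t" and ?H = "resolvent n N t" and ?w = "\<i> * complex_of_real t"
  have 1: "(\<Sum>k<n. \<Sum>l<n. ?H i k * of_real (N k l) * ?G l j) = ?G i j + ?w * (\<Sum>l<n. ?H i l * ?G l j)"
  proof -
    have "(\<Sum>k<n. \<Sum>l<n. ?H i k * of_real (N k l) * ?G l j) = (\<Sum>l<n. (\<Sum>k<n. ?H i k * of_real (N k l)) * ?G l j)"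
      by (subst sum.swap) (simp add: sum_distrib_right)
    also have "\<dots> = (\<Sum>l<n. (if l = i then ?G l j else 0) + ?w * (?H i l * ?G l j))"
    proof (intro sum.cong refl)
      fix l assume "l \<in> {..<n}"
      then have "(\<Sum>k<n. ?H i k * of_real (N k l)) = (if i = l then 1 else 0) + ?w * ?H i l"
        using resolvent_right [OF N t i, of l] by (simp add: algebra_simps)
      then show "(\<Sum>k<n. ?H i k * of_real (N k l)) * ?G l j = (if l = i then ?G l j else 0) + ?w * (?H i l * ?G l j)"
        by (simp add: algebra_simps)
    qed
    finally show ?thesis using i by (simp add: sum.distrib sum_distrib_left)
  qed
  have 2: "(\<Sum>k<n. \<Sum>l<n. ?H i k * of_real (M k l) * ?G l j) = ?H i j + ?w * (\<Sum>l<n. ?H i l * ?G l j)"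
  proof -
    have "(\<Sum>k<n. \<Sum>l<n. ?H i k * of_real (M k l) * ?G l j) = (\<Sum>k<n. ?H i k * (\<Sum>l<n. of_real (M k l) * ?G l j))"
      by (simp add: sum_distrib_left mult.assoc)
    also have "\<dots> = (\<Sum>k<n. (if k = j then ?H i k else 0) + ?w * (?H i k * ?G k j))"
    proof (intro sum.cong refl)
      fix k assume "k \<in> {..<n}"
      then have "(\<Sum>l<n. of_real (M k l) * ?G l j) = (if k = j then 1 else 0) + ?w * ?G k j"
        using resolvent_left [OF M t _ j, of k] by (simp add: algebra_simps)
      then show "?H i k * (\<Sum>l<n. of_real (M k l) * ?G l j) = (if k = j then ?H i k else 0) + ?w * (?H i k * ?G k j)"
        by (simp add: algebra_simps)
    qed
    finally show ?thesis using j by (simp add: sum.distrib sum_distrib_left)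
  qed
  have "(\<Sum>k<n. \<Sum>l<n. ?H i k * of_real (N k l - M k l) * ?G l j)
    = (\<Sum>k<n. \<Sum>l<n. ?H i k * of_real (N k l) * ?G l j) - (\<Sum>k<n. \<Sum>l<n. ?H i k * of_real (M k l) * ?G l j)"
    by (simp add: sum_subtractf algebra_simps)
  with 1 2 show ?thesis by simp
qed

lemma sum_le_sqrt_card_L2:
  "(\<Sum>i<n. \<bar>f i\<bar>) \<le> sqrt (real n) * L2_set f {..<n}"
proof -
  have "(\<Sum>i<n. \<bar>1\<bar> * \<bar>f i\<bar>) \<le> L2_set (\<lambda>_. 1) {..<n} * L2_set f {..<n}"
    by (rule L2_set_mult_ineq)
  then show ?thesis by (simp add: L2_set_def)
qed

text \<open>By the resolvent identity the difference of the traces is \<open>tr ((N - M) K)\<close> with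
  \<open>K = G H\<close>, whose operator norm is at most \<open>1 / t\<^sup>2\<close>. The constant matrix \<open>c J\<close> has rank one and
  contributes \<open>c \<langle>1, K 1\<rangle>\<close>, which is of order \<open>c n\<close>; treating it by its Frobenius norm would cost a
  factor \<open>sqrt n\<close>. For the remainder \<open>E\<close>, Cauchy-Schwarz and \<open>\<parallel>K\<parallel>\<^sub>F \<le> sqrt n / t\<^sup>2\<close> suffice.\<close>

lemma resolvent_trace_perturbation:
  assumes M: "sym_on n M" and N: "sym_on n N" and t: "t > 0"
    and diff: "\<And>k l. k < n \<Longrightarrow> l < n \<Longrightarrow> N k l - M k l = c + E k l"
  shows "cmod ((\<Sum>i<n. resolvent n M t i i) - (\<Sum>i<n. resolvent n N t i i))
    \<le> (\<bar>c\<bar> * n + sqrt n * sqrt (\<Sum>k<n. \<Sum>l<n. (E k l)\<^sup>2)) / t\<^sup>2"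
proof -
  let ?G = "resolvent n M t" and ?H = "resolvent n N t"
  define K where "K l k = (\<Sum>i<n. ?G l i * ?H i k)" for l k
  have Kcol: "vnorm n (\<lambda>l. K l k) \<le> 1 / t\<^sup>2" if "k < n" for k
  proof -
    have "vnorm n (\<lambda>l. K l k) \<le> vnorm n (\<lambda>i. ?H i k) / t"
      unfolding K_def by (rule resolvent_bound [OF M t])
    also have "\<dots> \<le> (1 / t) / t"
      using t by (intro divide_right_mono resolvent_column_bound N that) auto
    finally show ?thesis by (simp add: power2_eq_square)
  qed
  have K1: "vnorm n (\<lambda>l. \<Sum>k<n. K l k) \<le> sqrt n / t\<^sup>2"
  proof -
    have "(\<Sum>k<n. K l k) = (\<Sum>i<n. ?G l i * (\<Sum>k<n. ?H i k * 1))" for l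
      unfolding K_def by (subst sum.swap) (simp add: sum_distrib_left)
    then have "vnorm n (\<lambda>l. \<Sum>k<n. K l k) \<le> vnorm n (\<lambda>i. \<Sum>k<n. ?H i k * 1) / t"
      using resolvent_bound [OF M t, of "\<lambda>i. \<Sum>k<n. ?H i k * 1"] by simp
    also have "\<dots> \<le> (vnorm n (\<lambda>_. 1) / t) / t"
      using t by (intro divide_right_mono resolvent_bound N) auto
    finally show ?thesis by (simp add: power2_eq_square L2_set_def)
  qed
  have "(\<Sum>i<n. ?G i i) - (\<Sum>i<n. ?H i i)
      = (\<Sum>i<n. \<Sum>k<n. \<Sum>l<n. ?H i k * of_real (N k l - M k l) * ?G l i)"
    unfolding sum_subtractf [symmetric]
    by (intro sum.cong refl resolvent_difference M N t) auto
  also have "\<dots> = (\<Sum>k<n. \<Sum>i<n. \<Sum>l<n. ?H i k * of_real (N k l - M k l) * ?G l i)"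
    by (rule sum.swap)
  also have "\<dots> = (\<Sum>k<n. \<Sum>l<n. \<Sum>i<n. ?H i k * of_real (N k l - M k l) * ?G l i)"
    by (rule sum.cong [OF refl]) (rule sum.swap)
  also have "\<dots> = (\<Sum>k<n. \<Sum>l<n. of_real (N k l - M k l) * K l k)"
    by (simp add: K_def sum_distrib_left mult_ac)
  also have "\<dots> = (\<Sum>k<n. \<Sum>l<n. of_real c * K l k) + (\<Sum>k<n. \<Sum>l<n. of_real (E k l) * K l k)"
    unfolding sum.distrib [symmetric] by (intro sum.cong refl) (simp add: diff algebra_simps)
  also have "(\<Sum>k<n. \<Sum>l<n. of_real c * K l k) = of_real c * (\<Sum>l<n. \<Sum>k<n. K l k)"
    by (subst sum.swap) (simp add: sum_distrib_left)
  also have "cmod (of_real c * (\<Sum>l<n. \<Sum>k<n. K l k) + (\<Sum>k<n. \<Sum>l<n. of_real (E k l) * K l k))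
    \<le> \<bar>c\<bar> * (n / t\<^sup>2) + sqrt n * sqrt (\<Sum>k<n. \<Sum>l<n. (E k l)\<^sup>2) * (1 / t\<^sup>2)"
  proof (rule norm_triangle_mono)
    have "cmod (\<Sum>l<n. \<Sum>k<n. K l k) \<le> (\<Sum>l<n. \<bar>cmod (\<Sum>k<n. K l k)\<bar>)"
      by (rule order_trans [OF norm_sum]) simp
    also have "\<dots> \<le> sqrt n * (sqrt n / t\<^sup>2)"
      by (rule order_trans [OF sum_le_sqrt_card_L2]) (intro mult_left_mono K1, simp)
    finally show "cmod (of_real c * (\<Sum>l<n. \<Sum>k<n. K l k)) \<le> \<bar>c\<bar> * (n / t\<^sup>2)"
      unfolding norm_mult norm_of_real by (intro mult_left_mono) auto
    have "cmod (\<Sum>k<n. \<Sum>l<n. of_real (E k l) * K l k) \<le> (\<Sum>k<n. \<Sum>l<n. \<bar>E k l\<bar> * \<bar>cmod (K l k)\<bar>)"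
      by (rule order_trans [OF norm_sum] sum_mono)+ (simp add: norm_mult)
    also have "\<dots> \<le> (\<Sum>k<n. L2_set (E k) {..<n} * (1 / t\<^sup>2))"
      by (intro sum_mono order_trans [OF L2_set_mult_ineq] mult_left_mono Kcol) (auto simp: L2_set_nonneg)
    also have "\<dots> = (\<Sum>k<n. \<bar>L2_set (E k) {..<n}\<bar>) * (1 / t\<^sup>2)"
      by (simp add: sum_divide_distrib L2_set_nonneg)
    also have "\<dots> \<le> sqrt n * L2_set (\<lambda>k. L2_set (E k) {..<n}) {..<n} * (1 / t\<^sup>2)"
      by (intro mult_right_mono sum_le_sqrt_card_L2) auto
    also have "L2_set (\<lambda>k. L2_set (E k) {..<n}) {..<n} = sqrt (\<Sum>k<n. \<Sum>l<n. (E k l)\<^sup>2)"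
      by (simp add: L2_set_def sum_nonneg)
    finally show "cmod (\<Sum>k<n. \<Sum>l<n. of_real (E k l) * K l k) \<le> sqrt n * sqrt (\<Sum>k<n. \<Sum>l<n. (E k l)\<^sup>2) * (1 / t\<^sup>2)" .
  qed
  finally show ?thesis by (simp add: add_divide_distrib)
qed

text \<open>Row and column \<open>i\<close> are set to zero instead of being deleted, so that the dimension stays
  \<open>n\<close> and the two resolvents can be compared entry by entry.\<close>

definition cavity :: "nat \<Rightarrow> (nat \<Rightarrow> nat \<Rightarrow> real) \<Rightarrow> nat \<Rightarrow> nat \<Rightarrow> real" where
  "cavity i M = (\<lambda>k l. if k = i \<or> l = i then 0 else M k l)"

lemma sym_on_cavity: "sym_on n M \<Longrightarrow> sym_on n (cavity i M)"
  by (auto simp: sym_on_def cavity_def)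

text \<open>The Schur complement formula for a diagonal entry of the resolvent, written without
  division. Up to the factor \<open>- G\<^sub>i\<^sub>i\<close>, row \<open>i\<close> of \<open>G\<close> off the diagonal is row \<open>i\<close> of \<open>M\<close> times the cavity
  resolvent; inserting this in the diagonal entry of \<open>G (M - \<i> t) = I\<close> gives the equation.\<close>

lemma cavity_equation:
  assumes M: "sym_on n M" and t: "t > 0" and i: "i < n" and diag: "M i i = 0"
  shows "resolvent n M t i i * (\<i> * of_real t
    + (\<Sum>k<n. \<Sum>l<n. of_real (M i k * M i l) * resolvent n (cavity i M) t k l)) = -1"
proof -
  let ?G = "resolvent n M t" and ?w = "\<i> * complex_of_real t"
  define H where "H = resolvent n (cavity i M) t"
  note C = sym_on_cavity [OF M, of i]
  define u where "u l = (if l = i then 0 else ?G i l)" for l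
  \<comment> \<open>The truncated row satisfies \<open>u (N - \<i> t) = - G\<^sub>i\<^sub>i x\<close> for the cavity matrix \<open>N\<close> and the \<open>i\<close>-th row \<open>x\<close> of \<open>M\<close>.\<close>
  have row: "(\<Sum>l<n. u l * of_real (cavity i M l k)) - ?w * u k = - ?G i i * of_real (M i k)"
    if k: "k < n" for k
  proof (cases "k = i")
    case True
    then show ?thesis using diag by (simp add: cavity_def u_def)
  next
    case False
    have "(\<Sum>l<n. u l * of_real (cavity i M l k)) = (\<Sum>l<n. ?G i l * of_real (M l k) - (if l = i then ?G i i * of_real (M i k) else 0))"
      using False by (intro sum.cong refl) (auto simp: cavity_def u_def)
    also have "\<dots> = (\<Sum>l<n. ?G i l * of_real (M l k)) - ?G i i * of_real (M i k)"
      using i by (simp add: sum_subtractf)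
    finally show ?thesis
      using resolvent_right [OF M t i k] False by (simp add: u_def)
  qed
  have u_eq: "u l = - ?G i i * (\<Sum>k<n. of_real (M i k) * H k l)" if l: "l < n" for l
  proof -
    have "(\<Sum>k<n. ((\<Sum>m<n. u m * of_real (cavity i M m k)) - ?w * u k) * H k l)
        = (\<Sum>k<n. \<Sum>m<n. u m * of_real (cavity i M m k) * H k l) - (\<Sum>k<n. ?w * u k * H k l)"
      by (simp add: algebra_simps sum_subtractf sum_distrib_left)
    also have "(\<Sum>k<n. \<Sum>m<n. u m * of_real (cavity i M m k) * H k l)
        = (\<Sum>m<n. u m * (\<Sum>k<n. of_real (cavity i M m k) * H k l))"
      by (subst sum.swap) (simp add: sum_distrib_left mult.assoc)
    also have "\<dots> - (\<Sum>k<n. ?w * u k * H k l)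
        = (\<Sum>m<n. u m * ((\<Sum>k<n. of_real (cavity i M m k) * H k l) - ?w * H m l))"
      by (simp add: algebra_simps sum_subtractf)
    also have "\<dots> = (\<Sum>m<n. u m * (if m = l then 1 else 0))"
      unfolding H_def using resolvent_left [OF C t _ l] by (intro sum.cong refl) auto
    also have "\<dots> = u l" using l by (simp add: if_distrib [of "\<lambda>x. _ * x"] cong: if_cong)
    finally have "u l = (\<Sum>k<n. - ?G i i * of_real (M i k) * H k l)"
      using row by simp
    then show ?thesis by (simp add: sum_distrib_left mult.assoc sum_negf)
  qed
  have "1 + ?w * ?G i i = (\<Sum>l<n. ?G i l * of_real (M l i))"
    using resolvent_right [OF M t i i] by (simp add: algebra_simps)
  also have "\<dots> = (\<Sum>l<n. u l * of_real (M i l))"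
    using M i diag by (intro sum.cong refl) (auto simp: u_def sym_on_def)
  also have "\<dots> = (\<Sum>l<n. - ?G i i * (\<Sum>k<n. of_real (M i k) * H k l) * of_real (M i l))"
    by (intro sum.cong refl) (simp add: u_eq)
  also have "\<dots> = - ?G i i * (\<Sum>l<n. \<Sum>k<n. of_real (M i k * M i l) * H k l)"
    by (simp add: sum_distrib_left sum_distrib_right mult_ac sum_negf)
  also have "(\<Sum>l<n. \<Sum>k<n. of_real (M i k * M i l) * H k l) = (\<Sum>k<n. \<Sum>l<n. of_real (M i k * M i l) * H k l)"
    by (rule sum.swap)
  finally show ?thesis
    by (simp add: H_def algebra_simps eq_neg_iff_add_eq_0)
qed

text \<open>The Stieltjes transform of the empirical spectral distribution at the point \<open>\<i> t\<close>.\<close>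

definition stieltjes :: "nat \<Rightarrow> (nat \<Rightarrow> nat \<Rightarrow> real) \<Rightarrow> real \<Rightarrow> complex" where
  "stieltjes n M t = (\<Sum>i<n. resolvent n M t i i) / of_nat n"

text \<open>If the quadratic form in the cavity equation were equal to \<open>s m\<close> for every \<open>i\<close>, averaging
  \<open>G\<^sub>i\<^sub>i (\<i> t + s m) = - 1\<close> over \<open>i\<close> would give the quadratic equation of the semicircle law. The
  error is controlled by \<open>\<bar>G\<^sub>i\<^sub>i\<bar> \<le> 1 / t\<close>.\<close>

lemma self_consistent_error:
  assumes M: "sym_on n M" and t: "t > 0" and n: "n > 0" and diag: "\<And>i. i < n \<Longrightarrow> M i i = 0"
  shows "cmod (of_real s * (stieltjes n M t)\<^sup>2 + \<i> * of_real t * stieltjes n M t + 1)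
    \<le> (\<Sum>i<n. cmod (of_real s * stieltjes n M t
         - (\<Sum>k<n. \<Sum>l<n. of_real (M i k * M i l) * resolvent n (cavity i M) t k l))) / (n * t)"
proof -
  let ?m = "stieltjes n M t" and ?G = "resolvent n M t"
  define q where "q i = (\<Sum>k<n. \<Sum>l<n. of_real (M i k * M i l) * resolvent n (cavity i M) t k l)" for i
  have q: "?G i i * q i = - 1 - \<i> * of_real t * ?G i i" if "i < n" for i
    using cavity_equation [OF M t that diag [OF that]] by (simp add: q_def algebra_simps)
  have nm: "of_nat n * ?m = (\<Sum>i<n. ?G i i)" using n by (simp add: stieltjes_def)
  have "(\<Sum>i<n. ?G i i * (of_real s * ?m - q i))
      = (\<Sum>i<n. (of_real s * ?m + \<i> * of_real t) * ?G i i + 1)"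
    by (rule sum.cong [OF refl]) (simp add: right_diff_distrib q, simp add: algebra_simps)
  also have "\<dots> = of_nat n * (of_real s * ?m\<^sup>2 + \<i> * of_real t * ?m + 1)"
    by (simp add: sum.distrib sum_distrib_left [symmetric] nm [symmetric] power2_eq_square algebra_simps)
  finally have "n * cmod (of_real s * ?m\<^sup>2 + \<i> * of_real t * ?m + 1)
      = cmod (\<Sum>i<n. ?G i i * (of_real s * ?m - q i))"
    by (simp add: norm_mult)
  also have "\<dots> \<le> (\<Sum>i<n. cmod (?G i i) * cmod (of_real s * ?m - q i))"
    by (rule order_trans [OF norm_sum]) (simp add: norm_mult)
  also have "\<dots> \<le> (\<Sum>i<n. (1 / t) * cmod (of_real s * ?m - q i))"
    by (intro sum_mono mult_right_mono resolvent_entry_bound M t) auto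
  also have "\<dots> = (\<Sum>i<n. cmod (of_real s * ?m - q i)) / t"
    by (simp add: sum_divide_distrib)
  finally have "cmod (of_real s * ?m\<^sup>2 + \<i> * of_real t * ?m + 1)
      \<le> (\<Sum>i<n. cmod (of_real s * ?m - q i)) / t / n"
    using n by (subst pos_le_divide_eq) (simp_all add: mult.commute)
  then show ?thesis by (simp add: q_def mult.commute)
qed

text \<open>The cavity changes only one row and one column, each of Euclidean norm at most one.\<close>

lemma stieltjes_cavity:
  assumes M: "sym_on n M" and t: "t > 0" and n: "n > 0" and i: "i < n" and row: "(\<Sum>k<n. (M i k)\<^sup>2) \<le> 1"
  shows "cmod (stieltjes n M t - stieltjes n (cavity i M) t) \<le> 2 / (sqrt n * t\<^sup>2)"
proof -
  have "cavity i M k l - M k l = 0 + - (if k = i \<or> l = i then M k l else 0)" for k l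
    by (simp add: cavity_def)
  from resolvent_trace_perturbation [OF M sym_on_cavity [OF M] t this]
  have "cmod ((\<Sum>i<n. resolvent n M t i i) - (\<Sum>j<n. resolvent n (cavity i M) t j j))
    \<le> sqrt n * sqrt (\<Sum>k<n. \<Sum>l<n. (if k = i \<or> l = i then M k l else 0)\<^sup>2) / t\<^sup>2" by simp
  also have "\<dots> \<le> sqrt n * 2 / t\<^sup>2"
  proof (intro divide_right_mono mult_left_mono)
    have "(\<Sum>k<n. \<Sum>l<n. (if k = i \<or> l = i then M k l else 0)\<^sup>2)
        \<le> (\<Sum>k<n. \<Sum>l<n. (if k = i then (M i l)\<^sup>2 else 0) + (if l = i then (M i k)\<^sup>2 else 0))"
      using M i by (intro sum_mono) (auto simp: sym_on_def)
    also have "\<dots> = (\<Sum>l<n. (M i l)\<^sup>2) + (\<Sum>k<n. (M i k)\<^sup>2)"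
    proof -
      have "(\<Sum>k<n. \<Sum>l<n. (if k = i then (M i l)\<^sup>2 else 0)) = (\<Sum>k<n. if k = i then \<Sum>l<n. (M i l)\<^sup>2 else 0)"
        by (intro sum.cong) auto
      then show ?thesis using i by (simp add: sum.distrib)
    qed
    also have "\<dots> \<le> 4" using row by simp
    finally show "sqrt (\<Sum>k<n. \<Sum>l<n. (if k = i \<or> l = i then M k l else 0)\<^sup>2) \<le> 2"
      by (simp add: real_le_lsqrt)
  qed auto
  finally have "cmod ((\<Sum>i<n. resolvent n M t i i) - (\<Sum>j<n. resolvent n (cavity i M) t j j)) / n \<le> sqrt n * 2 / t\<^sup>2 / n"
    by (intro divide_right_mono) auto
  moreover have "sqrt n * 2 / t\<^sup>2 / n = 2 / (sqrt n * t\<^sup>2)"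
  proof -
    have "sqrt n * sqrt n = n" "sqrt n > 0" using n by auto
    then show ?thesis using t by (simp add: field_simps)
  qed
  ultimately show ?thesis
    by (simp add: stieltjes_def diff_divide_distrib [symmetric] norm_divide)
qed

section \<open>The semicircle equation and Coulson's integral formula\<close>

text \<open>The imaginary part, at the point \<open>\<i> t\<close>, of the Stieltjes transform of the semicircle law
  with variance \<open>s\<close>; the real part is zero by symmetry.\<close>

definition semicircle_stieltjes :: "real \<Rightarrow> real \<Rightarrow> real" where
  "semicircle_stieltjes s t = (sqrt (t\<^sup>2 + 4 * s) - t) / (2 * s)"

lemma semicircle_stieltjes_eq:
  assumes "s > 0"
  shows "s * (semicircle_stieltjes s t)\<^sup>2 + t * semicircle_stieltjes s t = 1"
proof -
  define r where "r = sqrt (t\<^sup>2 + 4 * s)"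
  have r: "r\<^sup>2 = t\<^sup>2 + 4 * s" using assms by (simp add: r_def)
  have "s * ((r - t) / (2 * s))\<^sup>2 + t * ((r - t) / (2 * s)) = (r\<^sup>2 - t\<^sup>2) / (4 * s)"
    using assms by (simp add: power2_eq_square field_simps)
  also have "\<dots> = 1" using assms by (simp add: r)
  finally show ?thesis by (simp add: semicircle_stieltjes_def r_def)
qed

lemma semicircle_stieltjes_pos:
  assumes "s > 0"
  shows "semicircle_stieltjes s t > 0"
proof -
  have "t < sqrt (t\<^sup>2 + 4 * s)" using assms by (intro real_less_rsqrt) auto
  then show ?thesis using assms by (simp add: semicircle_stieltjes_def)
qed

text \<open>The quadratic polynomial factors as \<open>(m - \<i> g) (s (m + \<i> g) + \<i> t)\<close>, and the second factor
  has imaginary part at least \<open>t\<close> as soon as \<open>m\<close> lies in the closed upper half plane.\<close>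

lemma semicircle_equation_stability:
  assumes s: "s > 0" and t: "t > 0" and m: "Im m \<ge> 0"
  shows "cmod (m - \<i> * of_real (semicircle_stieltjes s t))
    \<le> cmod (of_real s * m\<^sup>2 + \<i> * of_real t * m + 1) / t"
proof -
  define g where "g = semicircle_stieltjes s t"
  have g: "complex_of_real s * (of_real g)\<^sup>2 + of_real t * of_real g = 1"
    using semicircle_stieltjes_eq [OF s, of t] unfolding g_def
    by (metis of_real_1 of_real_add of_real_mult of_real_power)
  have expand: "(m - j * G) * (S * (m + j * G) + j * T) = S * m\<^sup>2 + j * T * m - (j * j) * (S * G\<^sup>2 + T * G)"
    for m j G S T :: complex by (simp add: algebra_simps power2_eq_square)
  have "of_real s * m\<^sup>2 + \<i> * of_real t * m + 1
      = of_real s * m\<^sup>2 + \<i> * of_real t * m + (of_real s * (of_real g)\<^sup>2 + of_real t * of_real g)"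
    by (simp add: g)
  also have "\<dots> = (m - \<i> * of_real g) * (of_real s * (m + \<i> * of_real g) + \<i> * of_real t)"
    using expand [of m "\<i>" "of_real g" "of_real s" "of_real t"] by simp
  finally have fac: "cmod (of_real s * m\<^sup>2 + \<i> * of_real t * m + 1)
      = cmod (m - \<i> * of_real g) * cmod (of_real s * (m + \<i> * of_real g) + \<i> * of_real t)"
    by (simp add: norm_mult)
  have "t \<le> Im (of_real s * (m + \<i> * of_real g) + \<i> * of_real t)"
    using s m semicircle_stieltjes_pos [OF s, of t] by (simp add: g_def)
  also have "\<dots> \<le> cmod (of_real s * (m + \<i> * of_real g) + \<i> * of_real t)"
    using abs_Im_le_cmod abs_le_D1 by blast
  finally have "cmod (m - \<i> * of_real g) * t \<le> cmod (of_real s * m\<^sup>2 + \<i> * of_real t * m + 1)"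
    unfolding fac by (intro mult_left_mono) auto
  then show ?thesis using t by (simp add: g_def field_simps)
qed

text \<open>The integrand of Coulson's formula: for eigenvalues \<open>\<lambda>\<^sub>1, \<dots>, \<lambda>\<^sub>n\<close> it is the mean of
  \<open>\<lambda>\<^sub>i\<^sup>2 / (\<lambda>\<^sub>i\<^sup>2 + t\<^sup>2)\<close>.\<close>

definition coulson :: "nat \<Rightarrow> (nat \<Rightarrow> nat \<Rightarrow> real) \<Rightarrow> real \<Rightarrow> real" where
  "coulson n M t = 1 - t * Im (stieltjes n M t)"

lemma has_bochner_integral_FTC_greaterThan:
  fixes f F :: "real \<Rightarrow> real"
  assumes "f \<in> borel_measurable borel"
    and "\<And>x. 0 \<le> x \<Longrightarrow> DERIV F x :> f x" and nonneg: "\<And>x. 0 \<le> x \<Longrightarrow> 0 \<le> f x"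
    and lim: "(F \<longlongrightarrow> T) at_top"
  shows "has_bochner_integral lborel (\<lambda>t. indicator {0<..} t * f t) (T - F 0)"
proof (rule has_bochner_integral_nn_integral)
  have "F 0 \<le> T"
  proof (rule tendsto_lowerbound [OF lim])
    show "\<forall>\<^sub>F x in at_top. F 0 \<le> F x"
    proof (rule eventually_at_top_linorderI [of 0])
      fix x :: real assume "0 \<le> x"
      then show "F 0 \<le> F x"
        using assms(2,3) by (intro DERIV_nonneg_imp_nondecreasing [of 0 x F]) auto
    qed
  qed auto
  then show "0 \<le> T - F 0" by simp
  show "(\<lambda>t. indicator {0<..} t * f t) \<in> borel_measurable lborel"
    using assms(1) by simp
  show "AE t in lborel. 0 \<le> indicator {0<..} t * f t"
    using nonneg by (intro AE_I2) (auto simp: indicator_def)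
  have "(\<integral>\<^sup>+t. ennreal (indicator {0<..} t * f t) \<partial>lborel) = (\<integral>\<^sup>+t. ennreal (f t) * indicator {0..} t \<partial>lborel)"
    by (intro nn_integral_cong_AE eventually_mono [OF AE_lborel_singleton [of 0]])
       (auto simp: indicator_def)
  also have "\<dots> = ennreal (T - F 0)"
    by (rule nn_integral_FTC_atLeast) (use assms in auto)
  finally show "(\<integral>\<^sup>+t. ennreal (indicator {0<..} t * f t) \<partial>lborel) = ennreal (T - F 0)" .
qed

lemma coulson_integral_abs:
  fixes e :: real
  shows "has_bochner_integral lborel (\<lambda>t. indicator {0<..} t * (e\<^sup>2 / (e\<^sup>2 + t\<^sup>2))) (pi / 2 * \<bar>e\<bar>)"
proof (cases "e = 0")
  case True
  then show ?thesis by (simp add: has_bochner_integral_zero)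
next
  case False
  define a where "a = \<bar>e\<bar>"
  have a: "a > 0" "e\<^sup>2 = a\<^sup>2" using False by (auto simp: a_def)
  have "has_bochner_integral lborel (\<lambda>t. indicator {0<..} t * (a\<^sup>2 / (a\<^sup>2 + t\<^sup>2)))
      (a * (pi / 2) - a * arctan (0 / a))"
  proof (rule has_bochner_integral_FTC_greaterThan)
    show "((\<lambda>t. a * arctan (t / a)) has_real_derivative a\<^sup>2 / (a\<^sup>2 + x\<^sup>2)) (at x)" for x
    proof -
      have "a\<^sup>2 + x\<^sup>2 > 0" using a by (intro add_pos_nonneg) auto
      then show ?thesis
        using a by (auto intro!: derivative_eq_intros simp: field_simps power2_eq_square add_nonneg_eq_0_iff)
    qed
    have "filterlim (\<lambda>t. t / a) at_top at_top"
      using a filterlim_tendsto_pos_mult_at_top [OF tendsto_const [of "inverse a"] _ filterlim_ident [of at_top]]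
      by (simp add: divide_inverse mult.commute)
    then have "((\<lambda>t. arctan (t / a)) \<longlongrightarrow> pi / 2) at_top"
      using tendsto_arctan_at_top filterlim_compose by blast
    then show "((\<lambda>t. a * arctan (t / a)) \<longlongrightarrow> a * (pi / 2)) at_top"
      by (rule tendsto_mult_left)
  qed (use a in auto)
  then show ?thesis by (simp add: a(2) mult.commute flip: a_def)
qed

text \<open>Differentiating \<open>s g\<^sup>2 + t g = 1\<close> gives \<open>g' = - g\<^sup>2 / (1 + s g\<^sup>2)\<close>. Hence \<open>- (s g + s\<^sup>2 g\<^sup>3 / 3)\<close> is
  an antiderivative of \<open>s g\<^sup>2\<close>; it tends to zero at infinity, and \<open>g = 1 / sqrt s\<close> at the origin.
  Since \<open>s g\<^sup>2 = 1 - t g\<close>, this is the limiting value of Coulson's integral.\<close>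

lemma semicircle_integral:
  assumes s: "s > 0"
  shows "has_bochner_integral lborel
    (\<lambda>t. indicator {0<..} t * (s * (semicircle_stieltjes s t)\<^sup>2)) (4 / 3 * sqrt s)"
proof -
  define g where "g = semicircle_stieltjes s"
  define F where "F t = - (s * g t + s\<^sup>2 * (g t) ^ 3 / 3)" for t
  have eq: "s * (g t)\<^sup>2 + t * g t = 1" and pos: "g t > 0" for t
    using semicircle_stieltjes_eq [OF s] semicircle_stieltjes_pos [OF s] by (auto simp: g_def)
  have g_deriv: "(g has_real_derivative - ((g t)\<^sup>2 / (1 + s * (g t)\<^sup>2))) (at t)" for t
  proof -
    define r where "r = sqrt (t\<^sup>2 + 4 * s)"
    have rp: "t\<^sup>2 + 4 * s > 0" using s by (intro add_nonneg_pos) auto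
    then have r: "r > 0" by (simp add: r_def)
    have gr: "g t = (r - t) / (2 * s)" by (simp add: g_def semicircle_stieltjes_def r_def)
    have d: "(g has_real_derivative ((inverse r / 2 * (2 * t)) - 1) / (2 * s)) (at t)"
      unfolding g_def semicircle_stieltjes_def [abs_def] r_def
      using rp s by (auto intro!: derivative_eq_intros simp: field_simps)
    have "r = 2 * s * g t + t" using s by (simp add: gr)
    then have "r * g t = 1 + s * (g t)\<^sup>2"
      using eq [of t] by (simp add: algebra_simps power2_eq_square)
    then have "(g t)\<^sup>2 / (1 + s * (g t)\<^sup>2) = (g t)\<^sup>2 / (r * g t)" by simp
    also have "\<dots> = g t / r" using pos [of t] by (simp add: power2_eq_square)
    finally have "- ((g t)\<^sup>2 / (1 + s * (g t)\<^sup>2)) = - (g t / r)" by simp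
    also have "\<dots> = ((inverse r / 2 * (2 * t)) - 1) / (2 * s)"
      using r s unfolding gr by (simp add: field_simps)
    finally show ?thesis using d by simp
  qed
  have F_deriv: "(F has_real_derivative s * (g t)\<^sup>2) (at t)" for t
  proof -
    define d where "d = (g t)\<^sup>2 / (1 + s * (g t)\<^sup>2)"
    have "(g has_real_derivative - d) (at t)" using g_deriv by (simp add: d_def)
    then have "(F has_real_derivative - (s * - d + s\<^sup>2 * (3 * (g t)\<^sup>2 * - d) / 3)) (at t)"
      unfolding F_def by (auto intro!: derivative_eq_intros simp: power2_eq_square)
    then have "(F has_real_derivative (s + s\<^sup>2 * (g t)\<^sup>2) * d) (at t)"
      by (simp add: algebra_simps)
    moreover have "1 + s * (g t)\<^sup>2 > 0" using s by (intro add_pos_nonneg) auto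
    then have "(s + s\<^sup>2 * (g t)\<^sup>2) * ((g t)\<^sup>2 / (1 + s * (g t)\<^sup>2)) = s * (g t)\<^sup>2"
      by (simp add: divide_simps) (simp add: power2_eq_square algebra_simps)
    ultimately show ?thesis by (simp add: d_def)
  qed
  have g_lim: "(g \<longlongrightarrow> 0) at_top"
  proof (rule tendsto_sandwich [of "\<lambda>_. 0" _ _ "\<lambda>t. 1 / t"])
    show "\<forall>\<^sub>F t in at_top. 0 \<le> g t" using pos by (simp add: less_imp_le)
    show "\<forall>\<^sub>F t in at_top. g t \<le> 1 / t"
    proof (rule eventually_mono [OF eventually_gt_at_top [of 0]])
      fix t :: real assume "0 < t"
      moreover have "t * g t \<le> 1" using eq [of t] s zero_le_power2 [of "g t"]
        by (smt (verit) mult_nonneg_nonneg)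
      ultimately show "g t \<le> 1 / t" by (simp add: field_simps)
    qed
    show "((\<lambda>t::real. 1 / t) \<longlongrightarrow> 0) at_top"
      by (intro tendsto_divide_0 [OF tendsto_const] filterlim_at_top_imp_at_infinity filterlim_ident)
  qed auto
  have F_lim: "(F \<longlongrightarrow> - (s * 0 + s\<^sup>2 * 0 ^ 3 / 3)) at_top"
    unfolding F_def by (intro tendsto_intros g_lim) auto
  have "g \<in> borel_measurable borel"
    unfolding g_def semicircle_stieltjes_def [abs_def] by simp
  then have meas: "(\<lambda>t. s * (g t)\<^sup>2) \<in> borel_measurable borel" by simp
  have "has_bochner_integral lborel (\<lambda>t. indicator {0<..} t * (s * (g t)\<^sup>2)) (0 - F 0)"
    using has_bochner_integral_FTC_greaterThan [OF meas F_deriv _ F_lim] s by simp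
  moreover have "F 0 = - (4 / 3 * sqrt s)"
  proof -
    define r where "r = sqrt s"
    have r: "r > 0" "s = r\<^sup>2" using s by (auto simp: r_def)
    have "g 0 = 1 / r"
      using r by (simp add: g_def semicircle_stieltjes_def real_sqrt_mult power2_eq_square)
    then show ?thesis
      using r by (simp add: F_def r_def [symmetric] field_simps power2_eq_square power3_eq_cube)
  qed
  ultimately show ?thesis by (simp add: g_def)
qed

lemma coulson_spectrum:
  assumes M: "sym_on n M" and n: "n > 0" and c: "c > 0"
  obtains es :: "real list" where
    "energy (Matrix.mat n n (\<lambda>(i,j). M i j)) = (\<Sum>e\<leftarrow>es. \<bar>e\<bar>)"
    "length es = n"
    "(\<Sum>e\<leftarrow>es. e\<^sup>2) = (\<Sum>i<n. \<Sum>j<n. (M i j)\<^sup>2)"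
    "\<forall>t>0. Im (stieltjes n (\<lambda>i j. c * M i j) t) = (\<Sum>e\<leftarrow>es. t / ((c * e)\<^sup>2 + t\<^sup>2)) / n"
    "\<forall>t>0. coulson n (\<lambda>i j. c * M i j) t = (\<Sum>e\<leftarrow>es. (c * e)\<^sup>2 / ((c * e)\<^sup>2 + t\<^sup>2)) / n"
proof -
  obtain es where es: "proots (char_poly (Matrix.mat n n (\<lambda>(i,j). M i j))) = mset es"
    "length es = n"
    "(\<Sum>e\<leftarrow>es. e\<^sup>2) = (\<Sum>i<n. \<Sum>j<n. (M i j)\<^sup>2)"
    "\<forall>c. \<forall>t>0. (\<Sum>i<n. resolvent n (\<lambda>i j. c * M i j) t i i)
             = (\<Sum>e\<leftarrow>es. 1 / (of_real (c * e) - \<i> * of_real t))"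
    by (rule symmetric_spectrum [OF M])
  have en: "energy (Matrix.mat n n (\<lambda>(i,j). M i j)) = (\<Sum>e\<leftarrow>es. \<bar>e\<bar>)"
    unfolding energy_def es(1) by (simp flip: sum_mset_sum_list)
  have im: "Im (stieltjes n (\<lambda>i j. c * M i j) t) = (\<Sum>e\<leftarrow>es. t / ((c * e)\<^sup>2 + t\<^sup>2)) / n" if "t > 0" for t
  proof -
    have "Im (\<Sum>e\<leftarrow>es. 1 / (complex_of_real (c * e) - \<i> * complex_of_real t)) = (\<Sum>e\<leftarrow>es. t / ((c * e)\<^sup>2 + t\<^sup>2))" for es
      by (induction es) (auto simp: Im_divide)
    then show ?thesis
      using es(4) that by (simp add: stieltjes_def)
  qed
  have "coulson n (\<lambda>i j. c * M i j) t = (\<Sum>e\<leftarrow>es. (c * e)\<^sup>2 / ((c * e)\<^sup>2 + t\<^sup>2)) / n" if t: "t > 0" for t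
  proof -
    have "real (length es) - t * (\<Sum>e\<leftarrow>es. t / ((c * e)\<^sup>2 + t\<^sup>2)) = (\<Sum>e\<leftarrow>es. (c * e)\<^sup>2 / ((c * e)\<^sup>2 + t\<^sup>2))" for es
    proof (induction es)
      case (Cons e es)
      define D where "D = (c * e)\<^sup>2 + t\<^sup>2"
      have "D > 0" unfolding D_def using t by (intro add_nonneg_pos) auto
      then have "1 - t * (t / D) = (D - t\<^sup>2) / D"
        by (simp add: diff_divide_distrib power2_eq_square)
      then have "1 - t * (t / ((c * e)\<^sup>2 + t\<^sup>2)) = (c * e)\<^sup>2 / ((c * e)\<^sup>2 + t\<^sup>2)"
        by (simp add: D_def)
      with Cons show ?case by (simp add: algebra_simps)
    qed auto
    from this [of es] show ?thesis
      using n by (simp add: coulson_def im [OF t] es(2) field_simps)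
  qed
  with that en es im show thesis by blast
qed

lemma stieltjes_Im_nonneg:
  assumes "sym_on n M" "t > 0"
  shows "Im (stieltjes n M t) \<ge> 0"
proof (cases "n = 0")
  case False
  then have n: "n > 0" by simp
  obtain es :: "real list" where
    "\<forall>t>0. Im (stieltjes n (\<lambda>i j. 1 * M i j) t) = (\<Sum>e\<leftarrow>es. t / ((1 * e)\<^sup>2 + t\<^sup>2)) / n"
    by (rule coulson_spectrum [OF assms(1) n, of 1]) (simp, blast)
  then have "Im (stieltjes n (\<lambda>i j. 1 * M i j) t) = (\<Sum>e\<leftarrow>es. t / ((1 * e)\<^sup>2 + t\<^sup>2)) / n"
    using assms(2) by blast
  moreover have "(\<Sum>e\<leftarrow>es. t / ((1 * e)\<^sup>2 + t\<^sup>2)) \<ge> 0"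
    using assms(2) by (intro sum_list_nonneg) auto
  ultimately show ?thesis by simp
qed (simp add: stieltjes_def)

text \<open>The bound by a multiple of \<open>1 / (1 + t\<^sup>2)\<close> is integrable and involves the matrix only through
  its normalised Frobenius norm, so it provides dominated convergence in \<open>n\<close>.\<close>

lemma coulson_bounds:
  assumes M: "sym_on n M" and n: "n > 0" and t: "t > 0"
  shows "0 \<le> coulson n M t" "coulson n M t \<le> (1 + (\<Sum>i<n. \<Sum>j<n. (M i j)\<^sup>2) / n) / (1 + t\<^sup>2)"
proof -
  obtain es where es: "length es = n" "(\<Sum>e\<leftarrow>es. e\<^sup>2) = (\<Sum>i<n. \<Sum>j<n. (M i j)\<^sup>2)"
      "\<forall>t>0. coulson n (\<lambda>i j. 1 * M i j) t = (\<Sum>e\<leftarrow>es. (1 * e)\<^sup>2 / ((1 * e)\<^sup>2 + t\<^sup>2)) / n"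
    by (rule coulson_spectrum [OF M n, of 1]) (simp, blast)
  have c: "coulson n M t = (\<Sum>e\<leftarrow>es. e\<^sup>2 / (e\<^sup>2 + t\<^sup>2)) / n"
    using es(3) t by simp
  show "0 \<le> coulson n M t"
    unfolding c by (intro divide_nonneg_nonneg sum_list_nonneg) auto
  have "(\<Sum>e\<leftarrow>es. e\<^sup>2 / (e\<^sup>2 + t\<^sup>2)) \<le> (\<Sum>e\<leftarrow>es. (1 + e\<^sup>2) / (1 + t\<^sup>2))"
  proof (rule sum_list_mono)
    fix e :: real
    have "e\<^sup>2 + t\<^sup>2 > 0" "1 + t\<^sup>2 > 0" using t by (simp_all add: sum_power2_gt_zero_iff add_pos_nonneg)
    moreover have "e\<^sup>2 * (1 + t\<^sup>2) \<le> (1 + e\<^sup>2) * (e\<^sup>2 + t\<^sup>2)"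
      by (simp add: algebra_simps)
    ultimately show "e\<^sup>2 / (e\<^sup>2 + t\<^sup>2) \<le> (1 + e\<^sup>2) / (1 + t\<^sup>2)"
      by (simp only: pos_divide_le_eq times_divide_eq_left pos_le_divide_eq)
  qed
  also have "\<dots> = (real (length es) + (\<Sum>e\<leftarrow>es. e\<^sup>2)) / (1 + t\<^sup>2)"
    by (induction es) (auto simp: add_divide_distrib)
  finally have "(\<Sum>e\<leftarrow>es. e\<^sup>2 / (e\<^sup>2 + t\<^sup>2)) \<le> (n + (\<Sum>i<n. \<Sum>j<n. (M i j)\<^sup>2)) / (1 + t\<^sup>2)"
    by (simp add: es)
  then have "coulson n M t \<le> (n + (\<Sum>i<n. \<Sum>j<n. (M i j)\<^sup>2)) / (1 + t\<^sup>2) / n"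
    unfolding c by (intro divide_right_mono) auto
  also have "\<dots> = (1 + (\<Sum>i<n. \<Sum>j<n. (M i j)\<^sup>2) / n) / (1 + t\<^sup>2)"
    using n by (simp add: field_simps)
  finally show "coulson n M t \<le> (1 + (\<Sum>i<n. \<Sum>j<n. (M i j)\<^sup>2) / n) / (1 + t\<^sup>2)" .
qed

lemma coulson_integral:
  assumes M: "sym_on n M" and n: "n > 0" and c: "c > 0"
  shows "has_bochner_integral lborel (\<lambda>t. indicator {0<..} t * coulson n (\<lambda>i j. c * M i j) t)
    (pi / 2 * (c * energy (Matrix.mat n n (\<lambda>(i,j). M i j)) / n))"
proof -
  obtain es where es: "energy (Matrix.mat n n (\<lambda>(i,j). M i j)) = (\<Sum>e\<leftarrow>es. \<bar>e\<bar>)"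
    "\<forall>t>0. coulson n (\<lambda>i j. c * M i j) t = (\<Sum>e\<leftarrow>es. (c * e)\<^sup>2 / ((c * e)\<^sup>2 + t\<^sup>2)) / n"
    by (rule coulson_spectrum [OF M n c]) blast
  have "has_bochner_integral lborel (\<lambda>t. \<Sum>e\<leftarrow>es. indicator {0<..} t * ((c * e)\<^sup>2 / ((c * e)\<^sup>2 + t\<^sup>2)))
      (\<Sum>e\<leftarrow>es. pi / 2 * \<bar>c * e\<bar>)" for es
  proof (induction es)
    case (Cons e es)
    then show ?case
      unfolding list.map sum_list.Cons by (intro has_bochner_integral_add coulson_integral_abs)
  qed (simp add: has_bochner_integral_zero)
  from has_bochner_integral_divide_zero [OF this, of es n]
  have "has_bochner_integral lborel
     (\<lambda>t. (\<Sum>e\<leftarrow>es. indicator {0<..} t * ((c * e)\<^sup>2 / ((c * e)\<^sup>2 + t\<^sup>2))) / n) ((\<Sum>e\<leftarrow>es. pi / 2 * \<bar>c * e\<bar>) / n)"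
    by simp
  moreover have "(\<Sum>e\<leftarrow>es. indicator {0<..} t * ((c * e)\<^sup>2 / ((c * e)\<^sup>2 + t\<^sup>2))) / n
     = indicator {0<..} t * coulson n (\<lambda>i j. c * M i j) t" for t
    using es(2) by (cases "t > 0") (auto simp: sum_list_0)
  moreover have "(\<Sum>e\<leftarrow>es. pi / 2 * \<bar>c * e\<bar>) / n
      = pi / 2 * (c * energy (Matrix.mat n n (\<lambda>(i,j). M i j)) / n)"
  proof -
    have key: "(\<Sum>e\<leftarrow>es. pi / 2 * \<bar>c * e\<bar>) = pi / 2 * (c * (\<Sum>e\<leftarrow>es. \<bar>e\<bar>))"
      using c by (induction es) (auto simp: abs_mult algebra_simps)
    show ?thesis unfolding key es(1) by simp
  qed
  ultimately show ?thesis by simp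
qed

section \<open>Independent edges and quadratic forms\<close>

abbreviation coins :: "nat \<Rightarrow> real \<Rightarrow> (nat set \<Rightarrow> bool) pmf" where
  "coins n p \<equiv> Pi_pmf (vertex_pairs n) False (\<lambda>_. bernoulli_pmf p)"

lemma finite_vertex_pairs: "finite (vertex_pairs n)"
  unfolding vertex_pairs_def by (rule finite_subset [of _ "Pow {1..n}"]) auto

lemma finite_set_coins: "finite (set_pmf (coins n p))"
  by (rule finite_subset [OF set_Pi_pmf_subset']) (auto simp: finite_vertex_pairs)

lemma integrable_coins: "integrable (measure_pmf (coins n p)) (X :: _ \<Rightarrow> real)"
  by (intro integrable_measure_pmf_finite finite_set_coins)

lemma expectation_sum_coins:
  "measure_pmf.expectation (coins n p) (\<lambda>f. \<Sum>x\<in>A. X x f) = (\<Sum>x\<in>A. measure_pmf.expectation (coins n p) (X x :: _ \<Rightarrow> real))"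
  by (intro Bochner_Integration.integral_sum integrable_coins)

lemma expectation_mono_coins:
  "(\<And>f. X f \<le> Y f) \<Longrightarrow> measure_pmf.expectation (coins n p) X \<le> (measure_pmf.expectation (coins n p) Y :: real)"
  by (intro integral_mono integrable_coins)

text \<open>Integrating out the coin \<open>a\<close> first annihilates the product. All orthogonality relations
  below are instances of this fact.\<close>

lemma expectation_centred_factor:
  fixes h :: "bool \<Rightarrow> real" and F :: "('a \<Rightarrow> bool) \<Rightarrow> real"
  assumes A: "finite A" "a \<in> A" and p: "0 \<le> p" "p \<le> 1"
    and indep: "\<And>f b. F (f(a := b)) = F f"
    and centred: "p * h True + (1 - p) * h False = 0"
  shows "measure_pmf.expectation (Pi_pmf A False (\<lambda>_. bernoulli_pmf p)) (\<lambda>f. h (f a) * F f) = 0"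
proof -
  define Q where "Q = Pi_pmf (A - {a}) False (\<lambda>_. bernoulli_pmf p)"
  have fin: "finite (set_pmf Q)"
    unfolding Q_def by (rule finite_subset [OF set_Pi_pmf_subset']) (use A in auto)
  have "Pi_pmf (insert a (A - {a})) False (\<lambda>_. bernoulli_pmf p)
      = bernoulli_pmf p \<bind> (\<lambda>b. map_pmf (\<lambda>f. f(a := b)) Q)"
    using A unfolding Q_def by (subst Pi_pmf_insert') (auto simp: map_pmf_def)
  moreover have "insert a (A - {a}) = A" using A by auto
  ultimately have "measure_pmf.expectation (Pi_pmf A False (\<lambda>_. bernoulli_pmf p)) (\<lambda>f. h (f a) * F f)
      = (\<Sum>b\<in>UNIV. pmf (bernoulli_pmf p) b *\<^sub>R measure_pmf.expectation (map_pmf (\<lambda>f. f(a := b)) Q) (\<lambda>f. h (f a) * F f))"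
    using fin by (simp add: pmf_expectation_bind [where A = UNIV])
  also have "\<dots> = (\<Sum>b\<in>UNIV. pmf (bernoulli_pmf p) b * (h b * measure_pmf.expectation Q F))"
    by (simp add: indep)
  also have "\<dots> = (p * h True + (1 - p) * h False) * measure_pmf.expectation Q F"
    using p by (simp add: UNIV_bool algebra_simps)
  finally show ?thesis by (simp add: centred)
qed

text \<open>The centred adjacency matrix. Vertices are numbered from \<open>1\<close> and matrix indices from \<open>0\<close>,
  whence the successors.\<close>

definition wigner :: "real \<Rightarrow> (nat set \<Rightarrow> bool) \<Rightarrow> nat \<Rightarrow> nat \<Rightarrow> real" where
  "wigner p f k l = (if k = l then 0 else of_bool (f {Suc k, Suc l}) - p)"

lemma wigner_sym: "wigner p f k l = wigner p f l k"
  by (simp add: wigner_def insert_commute)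

lemma wigner_diag [simp]: "wigner p f k k = 0"
  by (simp add: wigner_def)

lemma wigner_bound: "0 \<le> p \<Longrightarrow> p \<le> 1 \<Longrightarrow> \<bar>wigner p f k l\<bar> \<le> 1"
  by (auto simp: wigner_def)

lemma wigner_sq_bound: "0 \<le> p \<Longrightarrow> p \<le> 1 \<Longrightarrow> (wigner p f k l)\<^sup>2 \<le> 1"
  using wigner_bound [of p f k l] by (simp add: abs_square_le_1)

lemma wigner_upd:
  "{k, l} \<noteq> {i, j} \<Longrightarrow> wigner p (f({Suc i, Suc j} := b)) k l = wigner p f k l"
  by (auto simp: wigner_def doubleton_eq_iff)

lemma edge_in_vertex_pairs: "i < n \<Longrightarrow> j < n \<Longrightarrow> i \<noteq> j \<Longrightarrow> {Suc i, Suc j} \<in> vertex_pairs n"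
  by (auto simp: vertex_pairs_def card_insert_if)

lemma expectation_wigner_factor:
  assumes p: "0 \<le> p" "p \<le> 1" and ik: "i < n" "k < n"
    and indep: "\<And>f b. F (f({Suc i, Suc k} := b)) = F f"
  shows "measure_pmf.expectation (coins n p) (\<lambda>f. wigner p f i k * F f) = 0"
proof (cases "i = k")
  case False
  then have "measure_pmf.expectation (coins n p) (\<lambda>f. (of_bool (f {Suc i, Suc k}) - p) * F f) = 0"
    by (intro expectation_centred_factor [where h = "\<lambda>b. of_bool b - p"] finite_vertex_pairs
        edge_in_vertex_pairs ik p indep) (auto simp: algebra_simps)
  with False show ?thesis by (simp add: wigner_def)
qed simp

text \<open>A product of two entries of row \<open>i\<close> minus its expectation. At \<open>k = l = i\<close> nothing is
  subtracted, since the diagonal entry is identically zero.\<close>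

definition wigner_pair :: "real \<Rightarrow> (nat set \<Rightarrow> bool) \<Rightarrow> nat \<Rightarrow> nat \<Rightarrow> nat \<Rightarrow> real" where
  "wigner_pair p f i k l =
     wigner p f i k * wigner p f i l - (if k = l \<and> k \<noteq> i then p * (1 - p) else 0)"

lemma wigner_pair_sym: "wigner_pair p f i k l = wigner_pair p f i l k"
  by (auto simp: wigner_pair_def)

lemma wigner_pair_bound:
  assumes "0 \<le> p" "p \<le> 1"
  shows "\<bar>wigner_pair p f i k l\<bar> \<le> 1"
proof (cases "k = l \<and> k \<noteq> i")
  case True
  have "0 \<le> p * (1 - p)" "p * (1 - p) \<le> 1"
    using assms by (auto intro: mult_le_one)
  moreover have "0 \<le> (wigner p f i k)\<^sup>2" "(wigner p f i k)\<^sup>2 \<le> 1"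
    using wigner_sq_bound [OF assms] by auto
  ultimately have "\<bar>(wigner p f i k)\<^sup>2 - p * (1 - p)\<bar> \<le> 1"
    unfolding abs_le_iff by linarith
  with True show ?thesis
    by (simp add: wigner_pair_def power2_eq_square)
next
  case False
  then show ?thesis
    using wigner_bound [OF assms, of f i] by (auto simp: wigner_pair_def abs_mult intro!: mult_le_one)
qed

text \<open>The edge joining \<open>i\<close> and \<open>k\<close> occurs in the first pair only, and the expectation over its
  coin is zero: for \<open>k \<noteq> l\<close> because entries are centred, for \<open>k = l\<close> because the variance has been
  subtracted.\<close>

lemma wigner_pair_orthogonal_unshared:
  assumes p: "0 \<le> p" "p \<le> 1" and i: "i < n" and k: "k < n" "k \<noteq> k'" "k \<noteq> l'"
    and indep: "\<And>f j b. \<Phi> (f({Suc i, Suc j} := b)) = \<Phi> f"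
  shows "measure_pmf.expectation (coins n p) (\<lambda>f. \<Phi> f * (wigner_pair p f i k l * wigner_pair p f i k' l')) = 0"
proof -
  have other: "wigner_pair p (f({Suc i, Suc k} := b)) i k' l' = wigner_pair p f i k' l'" for f b
    using k by (simp add: wigner_pair_def wigner_upd doubleton_eq_iff)
  consider "k = i" | "k = l" "k \<noteq> i" | "k \<noteq> l" "k \<noteq> i" by blast
  then show ?thesis
  proof cases
    case 1
    then show ?thesis by (simp add: wigner_pair_def)
  next
    case 2
    have "measure_pmf.expectation (coins n p)
        (\<lambda>f. ((of_bool (f {Suc i, Suc k}) - p)\<^sup>2 - p * (1 - p)) * (\<Phi> f * wigner_pair p f i k' l')) = 0"
      using 2 by (intro expectation_centred_factor [where h = "\<lambda>b. (of_bool b - p)\<^sup>2 - p * (1 - p)"]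
          finite_vertex_pairs edge_in_vertex_pairs i k p)
        (auto simp: indep other [unfolded 2(1)] algebra_simps power2_eq_square)
    moreover have "wigner_pair p f i k l = (of_bool (f {Suc i, Suc k}) - p)\<^sup>2 - p * (1 - p)" for f
      using 2 by (simp add: wigner_pair_def wigner_def power2_eq_square)
    ultimately show ?thesis by (simp add: mult_ac)
  next
    case 3
    have "measure_pmf.expectation (coins n p)
        (\<lambda>f. wigner p f i k * (\<Phi> f * wigner p f i l * wigner_pair p f i k' l')) = 0"
      using 3 by (intro expectation_wigner_factor p i k) (simp add: indep other wigner_upd doubleton_eq_iff)
    with 3 show ?thesis
      by (simp add: wigner_pair_def [of p _ i k l] mult_ac)
  qed
qed

text \<open>Unless the two pairs agree as unordered pairs, one of the four indices occurs in only one of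
  them.\<close>

lemma wigner_pair_orthogonal:
  assumes p: "0 \<le> p" "p \<le> 1" and lt: "i < n" "k < n" "l < n" "k' < n" "l' < n"
    and ne: "(k',l') \<noteq> (k,l)" "(k',l') \<noteq> (l,k)"
    and indep: "\<And>f j b. \<Phi> (f({Suc i, Suc j} := b)) = \<Phi> f"
  shows "measure_pmf.expectation (coins n p) (\<lambda>f. \<Phi> f * (wigner_pair p f i k l * wigner_pair p f i k' l')) = 0"
proof -
  note aux = wigner_pair_orthogonal_unshared [OF p lt(1) _ _ _ indep]
  consider "k \<noteq> k'" "k \<noteq> l'" | "l \<noteq> k'" "l \<noteq> l'" | "k' \<noteq> k" "k' \<noteq> l" | "l' \<noteq> k" "l' \<noteq> l"
    using ne by auto
  then show ?thesis
  proof cases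
    case 1
    then show ?thesis using aux lt by blast
  next
    case 2
    then show ?thesis using aux [of l k' l' k] lt by (simp add: wigner_pair_sym [of p _ i l k])
  next
    case 3
    then show ?thesis using aux [of k' k l l'] lt by (simp add: mult_ac)
  next
    case 4
    then show ?thesis using aux [of l' k l k'] lt by (simp add: wigner_pair_sym [of p _ i l' k'] mult_ac)
  qed
qed

text \<open>Expanding the square, only products of index pairs that agree up to order survive,
  and for a given pair \<open>(k, l)\<close> they contribute at most \<open>\<bar>H\<^sub>k\<^sub>l\<bar> (\<bar>H\<^sub>k\<^sub>l\<bar> + \<bar>H\<^sub>l\<^sub>k\<bar>)\<close> in mean. The coefficients \<open>H\<close> may be random as long as
  they do not depend on the edges at \<open>i\<close>, which is how the cavity resolvent enters.\<close>

lemma quadratic_form_variance: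
  assumes p: "0 \<le> p" "p \<le> 1" and i: "i < n"
    and indep: "\<And>f j b k l. H (f({Suc i, Suc j} := b)) k l = H f k l"
  shows "measure_pmf.expectation (coins n p) (\<lambda>f. (\<Sum>k<n. \<Sum>l<n. H f k l * wigner_pair p f i k l)\<^sup>2)
    \<le> 2 * measure_pmf.expectation (coins n p) (\<lambda>f. \<Sum>k<n. \<Sum>l<n. (H f k l)\<^sup>2)"
proof -
  let ?E = "measure_pmf.expectation (coins n p)"
  define P where "P = {..<n} \<times> {..<n}"
  define h where "h q f = H f (fst q) (snd q)" for q f
  define z where "z q f = wigner_pair p f i (fst q) (snd q)" for q f
  have fin: "finite P" by (simp add: P_def)
  have swap: "(\<Sum>q\<in>P. u (prod.swap q)) = (\<Sum>q\<in>P. u q)" for u :: "nat \<times> nat \<Rightarrow> real"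
    by (rule sum.reindex_bij_witness [of _ prod.swap prod.swap]) (auto simp: P_def)
  have entry: "?E (\<lambda>f. h q f * h r f * (z q f * z r f))
      \<le> (if r = q then ?E (\<lambda>f. (h q f)\<^sup>2) else 0)
       + (if r = prod.swap q then (?E (\<lambda>f. (h q f)\<^sup>2) + ?E (\<lambda>f. (h (prod.swap q) f)\<^sup>2)) / 2 else 0)"
    (is "?L \<le> ?R") if "q \<in> P" "r \<in> P" for q r
  proof -
    obtain k l k' l' where q: "q = (k,l)" and r: "r = (k',l')" by (cases q, cases r)
    have nonneg: "?E (\<lambda>f. (h u f)\<^sup>2) \<ge> 0" for u by simp
    have am: "h q f * h r f * (z q f * z r f) \<le> ((h q f)\<^sup>2 + (h r f)\<^sup>2) / 2" for f
    proof -
      have "h q f * h r f * (z q f * z r f) \<le> \<bar>h q f * h r f\<bar> * \<bar>z q f * z r f\<bar>"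
        by (simp flip: abs_mult)
      also have "\<dots> \<le> \<bar>h q f * h r f\<bar> * 1"
        using wigner_pair_bound [OF p]
        by (intro mult_left_mono) (auto simp: z_def abs_mult intro!: mult_le_one)
      also have "\<dots> \<le> ((h q f)\<^sup>2 + (h r f)\<^sup>2) / 2"
        using sum_squares_bound [of "\<bar>h q f\<bar>" "\<bar>h r f\<bar>"] by (simp add: abs_mult)
      finally show ?thesis .
    qed
    have "?L \<le> ?E (\<lambda>f. ((h q f)\<^sup>2 + (h r f)\<^sup>2) / 2)"
      by (intro expectation_mono_coins am)
    also have "\<dots> = (?E (\<lambda>f. (h q f)\<^sup>2) + ?E (\<lambda>f. (h r f)\<^sup>2)) / 2"
      by (simp add: Bochner_Integration.integral_add integrable_coins)
    finally have am': "?L \<le> (?E (\<lambda>f. (h q f)\<^sup>2) + ?E (\<lambda>f. (h r f)\<^sup>2)) / 2" .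
    consider "r = q" | "r = prod.swap q" "r \<noteq> q" | "r \<noteq> q" "r \<noteq> prod.swap q" by blast
    then show ?thesis
    proof cases
      case 1
      then have "?L \<le> ?E (\<lambda>f. (h q f)\<^sup>2)" using am' by simp
      moreover have "0 \<le> (if r = prod.swap q
          then (?E (\<lambda>f. (h q f)\<^sup>2) + ?E (\<lambda>f. (h (prod.swap q) f)\<^sup>2)) / 2 else 0)"
        using nonneg by (auto intro: add_nonneg_nonneg)
      ultimately show ?thesis unfolding if_P [OF 1] by linarith
    next
      case 2
      then show ?thesis using am' by simp
    next
      case 3
      have "?L = 0"
        unfolding h_def z_def q r fst_conv snd_conv
        by (rule wigner_pair_orthogonal [OF p i]) (use that 3 indep in \<open>auto simp: P_def q r\<close>)
      then show ?thesis using 3 by simp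
    qed
  qed
  have "?E (\<lambda>f. (\<Sum>k<n. \<Sum>l<n. H f k l * wigner_pair p f i k l)\<^sup>2)
      = ?E (\<lambda>f. \<Sum>q\<in>P. \<Sum>r\<in>P. h q f * h r f * (z q f * z r f))"
  proof (intro Bochner_Integration.integral_cong refl)
    fix f
    have "(\<Sum>k<n. \<Sum>l<n. H f k l * wigner_pair p f i k l) = (\<Sum>q\<in>P. h q f * z q f)"
      by (simp add: P_def h_def z_def sum.cartesian_product case_prod_beta)
    then show "(\<Sum>k<n. \<Sum>l<n. H f k l * wigner_pair p f i k l)\<^sup>2 = (\<Sum>q\<in>P. \<Sum>r\<in>P. h q f * h r f * (z q f * z r f))"
      by (simp add: power2_eq_square sum_product mult_ac)
  qed
  also have "\<dots> = (\<Sum>q\<in>P. \<Sum>r\<in>P. ?E (\<lambda>f. h q f * h r f * (z q f * z r f)))"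
    by (simp add: expectation_sum_coins)
  also have "\<dots> \<le> (\<Sum>q\<in>P. \<Sum>r\<in>P. (if r = q then ?E (\<lambda>f. (h q f)\<^sup>2) else 0)
       + (if r = prod.swap q then (?E (\<lambda>f. (h q f)\<^sup>2) + ?E (\<lambda>f. (h (prod.swap q) f)\<^sup>2)) / 2 else 0))"
    by (intro sum_mono entry)
  also have "\<dots> = (\<Sum>q\<in>P. ?E (\<lambda>f. (h q f)\<^sup>2) + (?E (\<lambda>f. (h q f)\<^sup>2) + ?E (\<lambda>f. (h (prod.swap q) f)\<^sup>2)) / 2)"
    using fin by (intro sum.cong refl) (auto simp: sum.distrib P_def)
  also have "\<dots> = 2 * (\<Sum>q\<in>P. ?E (\<lambda>f. (h q f)\<^sup>2))"
    using swap [of "\<lambda>q. ?E (\<lambda>f. (h q f)\<^sup>2)"]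
    by (simp add: sum.distrib add_divide_distrib sum_divide_distrib [symmetric] sum_distrib_left [symmetric])
  also have "(\<Sum>q\<in>P. ?E (\<lambda>f. (h q f)\<^sup>2)) = ?E (\<lambda>f. \<Sum>k<n. \<Sum>l<n. (H f k l)\<^sup>2)"
    by (simp add: expectation_sum_coins [symmetric] P_def h_def sum.cartesian_product case_prod_beta)
  finally show ?thesis .
qed

lemma row_sum_variance:
  assumes p: "0 \<le> p" "p \<le> 1" and i: "i < n"
  shows "measure_pmf.expectation (coins n p) (\<lambda>f. (\<Sum>k<n. wigner p f i k)\<^sup>2) \<le> n"
proof -
  let ?E = "measure_pmf.expectation (coins n p)"
  have "?E (\<lambda>f. (\<Sum>k<n. wigner p f i k)\<^sup>2) = (\<Sum>k<n. \<Sum>l<n. ?E (\<lambda>f. wigner p f i k * wigner p f i l))"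
    by (simp add: power2_eq_square sum_product expectation_sum_coins)
  also have "\<dots> \<le> (\<Sum>k<n. \<Sum>l<n. if l = k then 1 else 0)"
  proof (intro sum_mono)
    fix k l assume kl: "k \<in> {..<n}" "l \<in> {..<n}"
    show "?E (\<lambda>f. wigner p f i k * wigner p f i l) \<le> (if l = k then 1 else 0)"
    proof (cases "l = k")
      case True
      have "?E (\<lambda>f. wigner p f i k * wigner p f i l) \<le> ?E (\<lambda>_. 1)"
        using wigner_sq_bound [OF p] True by (intro expectation_mono_coins) (simp add: power2_eq_square)
      then show ?thesis using True by simp
    next
      case False
      then have "?E (\<lambda>f. wigner p f i k * wigner p f i l) = 0"
        using kl by (intro expectation_wigner_factor p i) (auto simp: wigner_upd doubleton_eq_iff)
      then show ?thesis using False by simp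
    qed
  qed
  also have "\<dots> = n" by simp
  finally show ?thesis .
qed

section \<open>The semicircle law for the centred adjacency matrix\<close>

definition scaled_wigner :: "nat \<Rightarrow> real \<Rightarrow> (nat set \<Rightarrow> bool) \<Rightarrow> nat \<Rightarrow> nat \<Rightarrow> real" where
  "scaled_wigner n p f = (\<lambda>k l. wigner p f k l / sqrt n)"

lemma sym_on_scaled_wigner: "sym_on n (scaled_wigner n p f)"
  by (simp add: sym_on_def scaled_wigner_def wigner_sym)

text \<open>The cavity matrix does not depend on the edges at \<open>i\<close>, hence neither does its resolvent.\<close>

lemma cavity_scaled_wigner_upd:
  "cavity i (scaled_wigner n p (f({Suc i, Suc j} := b))) = cavity i (scaled_wigner n p f)"
  by (auto simp: cavity_def scaled_wigner_def wigner_upd doubleton_eq_iff fun_eq_iff)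

lemma scaled_wigner_row:
  assumes "0 \<le> p" "p \<le> 1"
  shows "(\<Sum>k<n. (scaled_wigner n p f i k)\<^sup>2) \<le> 1"
proof (cases "n = 0")
  case False
  have "(\<Sum>k<n. (scaled_wigner n p f i k)\<^sup>2) \<le> (\<Sum>k<n. 1 / real n)"
    using wigner_sq_bound [OF assms] by (intro sum_mono) (simp add: scaled_wigner_def power_divide divide_right_mono)
  also have "\<dots> = 1" using False by simp
  finally show ?thesis .
qed simp

text \<open>The centred part, multiplied by \<open>n\<close>, of the quadratic form in the cavity equation.\<close>

definition cavity_fluctuation :: "nat \<Rightarrow> real \<Rightarrow> real \<Rightarrow> nat \<Rightarrow> (nat set \<Rightarrow> bool) \<Rightarrow> complex" where
  "cavity_fluctuation n p t i f = (\<Sum>k<n. \<Sum>l<n.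
     resolvent n (cavity i (scaled_wigner n p f)) t k l * of_real (wigner_pair p f i k l))"

text \<open>The second moment is of order \<open>n\<close> because the squared Frobenius norm of the resolvent is at
  most \<open>n / t\<^sup>2\<close>.\<close>

lemma cavity_fluctuation_L1:
  assumes p: "0 \<le> p" "p \<le> 1" and t: "t > 0" and i: "i < n"
  shows "measure_pmf.expectation (coins n p) (\<lambda>f. cmod (cavity_fluctuation n p t i f))
    \<le> sqrt n * (1 / 2 + 1 / t\<^sup>2)"
proof -
  let ?E = "measure_pmf.expectation (coins n p)"
  define H where "H f = resolvent n (cavity i (scaled_wigner n p f)) t" for f
  have indep: "H (f({Suc i, Suc j} := b)) = H f" for f j b
    by (simp add: H_def cavity_scaled_wigner_upd)
  have sq: "(cmod (cavity_fluctuation n p t i f))\<^sup>2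
      = (\<Sum>k<n. \<Sum>l<n. Re (H f k l) * wigner_pair p f i k l)\<^sup>2
      + (\<Sum>k<n. \<Sum>l<n. Im (H f k l) * wigner_pair p f i k l)\<^sup>2" for f
    by (simp add: cmod_power2 cavity_fluctuation_def H_def)
  have "?E (\<lambda>f. (cmod (cavity_fluctuation n p t i f))\<^sup>2)
      = ?E (\<lambda>f. (\<Sum>k<n. \<Sum>l<n. Re (H f k l) * wigner_pair p f i k l)\<^sup>2)
      + ?E (\<lambda>f. (\<Sum>k<n. \<Sum>l<n. Im (H f k l) * wigner_pair p f i k l)\<^sup>2)"
    unfolding sq by (intro Bochner_Integration.integral_add integrable_coins)
  also have "\<dots> \<le> 2 * ?E (\<lambda>f. \<Sum>k<n. \<Sum>l<n. (Re (H f k l))\<^sup>2) + 2 * ?E (\<lambda>f. \<Sum>k<n. \<Sum>l<n. (Im (H f k l))\<^sup>2)"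
    by (intro add_mono quadratic_form_variance p i) (simp_all add: indep)
  also have "\<dots> = 2 * ?E (\<lambda>f. (\<Sum>k<n. \<Sum>l<n. (Re (H f k l))\<^sup>2) + (\<Sum>k<n. \<Sum>l<n. (Im (H f k l))\<^sup>2))"
    by (simp add: Bochner_Integration.integral_add integrable_coins)
  also have "\<dots> = 2 * ?E (\<lambda>f. \<Sum>k<n. \<Sum>l<n. (cmod (H f k l))\<^sup>2)"
    by (simp add: cmod_power2 sum.distrib)
  also have "\<dots> \<le> 2 * ?E (\<lambda>_. n / t\<^sup>2)"
    unfolding H_def
    by (intro mult_left_mono expectation_mono_coins resolvent_frobenius sym_on_cavity sym_on_scaled_wigner t) auto
  finally have var: "?E (\<lambda>f. (cmod (cavity_fluctuation n p t i f))\<^sup>2) \<le> 2 * n / t\<^sup>2" by simp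
  have n: "sqrt n > 0" "sqrt n * sqrt n = n" using i by auto
  \<comment> \<open>The arithmetic-geometric mean inequality with weight \<open>sqrt n\<close> passes from the second moment to the first.\<close>
  have "cmod (cavity_fluctuation n p t i f) \<le> sqrt n / 2 + (cmod (cavity_fluctuation n p t i f))\<^sup>2 / (2 * sqrt n)" for f
  proof -
    define y where "y = cmod (cavity_fluctuation n p t i f)"
    have "2 * sqrt n * y \<le> sqrt n * sqrt n + y\<^sup>2"
      using sum_squares_bound [of "sqrt n" y] by (simp add: power2_eq_square)
    then have "y \<le> (sqrt n * sqrt n + y\<^sup>2) / (2 * sqrt n)"
      using n by (simp only: pos_le_divide_eq mult_pos_pos zero_less_numeral mult_ac)
    also have "\<dots> = sqrt n / 2 + y\<^sup>2 / (2 * sqrt n)"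
      by (simp add: add_divide_distrib real_div_sqrt)
    finally show ?thesis by (simp add: y_def)
  qed
  then have "?E (\<lambda>f. cmod (cavity_fluctuation n p t i f))
      \<le> ?E (\<lambda>f. sqrt n / 2 + (cmod (cavity_fluctuation n p t i f))\<^sup>2 / (2 * sqrt n))"
    by (intro expectation_mono_coins)
  also have "\<dots> = sqrt n / 2 + ?E (\<lambda>f. (cmod (cavity_fluctuation n p t i f))\<^sup>2) / (2 * sqrt n)"
    by (simp add: Bochner_Integration.integral_add integrable_coins)
  also have "\<dots> \<le> sqrt n / 2 + (2 * n / t\<^sup>2) / (2 * sqrt n)"
    using n by (intro add_left_mono divide_right_mono var) auto
  also have "(2 * n / t\<^sup>2) / (2 * sqrt n) = sqrt n / t\<^sup>2"
  proof -
    have "(2 * n / t\<^sup>2) / (2 * sqrt n) = (n / sqrt n) / t\<^sup>2" by simp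
    also have "n / sqrt n = sqrt n" by (rule real_div_sqrt) simp
    finally show ?thesis .
  qed
  finally show ?thesis by (simp add: algebra_simps)
qed

text \<open>Three errors arise when the quadratic form is replaced by \<open>p (1 - p) m\<close>: the change of the
  trace caused by the cavity, the missing \<open>i\<close>-th diagonal term, and the fluctuation.\<close>

lemma cavity_quadratic_form:
  assumes p: "0 \<le> p" "p \<le> 1" and t: "t > 0" and i: "i < n"
  defines "M \<equiv> \<lambda>f. scaled_wigner n p f"
  shows "cmod (of_real (p * (1 - p)) * stieltjes n (M f) t
      - (\<Sum>k<n. \<Sum>l<n. of_real (M f i k * M f i l) * resolvent n (cavity i (M f)) t k l))
    \<le> (2 / t\<^sup>2 + 1 / t) / sqrt n + cmod (cavity_fluctuation n p t i f) / n"
proof -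
  define s where "s = p * (1 - p)"
  have s: "0 \<le> s" "s \<le> 1" using p by (auto simp: s_def intro: mult_le_one)
  define H where "H = resolvent n (cavity i (M f)) t"
  note sym = sym_on_scaled_wigner [of n p f, folded M_def]
  have n: "n > 0" "sqrt n * sqrt n = n" "real n \<ge> 1" using i by auto
  have prod: "of_real (M f i k * M f i l) * H k l
      = (H k l * of_real (wigner_pair p f i k l) + (if l = k then (if k = i then 0 else of_real s * H k k) else 0)) / of_nat n"
    if "k < n" "l < n" for k l
  proof -
    have "M f i k * M f i l = wigner p f i k * wigner p f i l / n"
      using n by (simp add: M_def scaled_wigner_def)
    also have "wigner p f i k * wigner p f i l = wigner_pair p f i k l + (if l = k then (if k = i then 0 else s) else 0)"
      by (simp add: wigner_pair_def s_def)
    finally show ?thesis by (simp add: algebra_simps)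
  qed
  have "(\<Sum>k<n. \<Sum>l<n. of_real (M f i k * M f i l) * H k l)
      = (\<Sum>k<n. \<Sum>l<n. (H k l * of_real (wigner_pair p f i k l) + (if l = k then (if k = i then 0 else of_real s * H k k) else 0)) / of_nat n)"
    by (intro sum.cong refl prod) auto
  also have "\<dots> = (cavity_fluctuation n p t i f + (\<Sum>k<n. if k = i then 0 else of_real s * H k k)) / of_nat n"
    unfolding sum_divide_distrib [symmetric] by (simp add: sum.distrib cavity_fluctuation_def H_def M_def)
  also have "(\<Sum>k<n. if k = i then 0 else of_real s * H k k) = (\<Sum>k<n. of_real s * H k k - (if k = i then of_real s * H i i else 0))"
    by (intro sum.cong) auto
  also have "\<dots> = of_real s * (of_nat n * stieltjes n (cavity i (M f)) t) - of_real s * H i i"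
    using i by (simp add: sum_subtractf sum_distrib_left [symmetric] stieltjes_def H_def)
  finally have q: "(\<Sum>k<n. \<Sum>l<n. of_real (M f i k * M f i l) * H k l)
      = cavity_fluctuation n p t i f / of_nat n + of_real s * stieltjes n (cavity i (M f)) t - of_real s * H i i / of_nat n"
    using n by (simp add: add_divide_distrib diff_divide_distrib)
  have "of_real s * stieltjes n (M f) t - (\<Sum>k<n. \<Sum>l<n. of_real (M f i k * M f i l) * H k l)
     = of_real s * (stieltjes n (M f) t - stieltjes n (cavity i (M f)) t) + of_real s * H i i / of_nat n
       - cavity_fluctuation n p t i f / of_nat n"
    unfolding q by (simp add: algebra_simps)
  also have "cmod \<dots> \<le> (2 / t\<^sup>2 + 1 / t) / sqrt n + cmod (cavity_fluctuation n p t i f) / n"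
  proof (rule order_trans [OF norm_triangle_ineq4 add_mono])
    have "cmod (of_real s * (stieltjes n (M f) t - stieltjes n (cavity i (M f)) t)) \<le> 1 * (2 / (sqrt n * t\<^sup>2))"
      unfolding norm_mult using s
      by (intro mult_mono stieltjes_cavity sym t n i) (auto simp: M_def scaled_wigner_row [OF p])
    moreover have "cmod (of_real s * H i i / of_nat n) \<le> 1 * (1 / t) / sqrt n"
      unfolding norm_mult norm_divide
    proof (intro frac_le mult_mono)
      show "cmod (H i i) \<le> 1 / t"
        unfolding H_def by (intro resolvent_entry_bound sym_on_cavity sym t i)
      show "sqrt n \<le> cmod (of_nat n)" using n by (simp add: real_le_lsqrt power2_eq_square)
    qed (use s t n in auto)
    ultimately have "cmod (of_real s * (stieltjes n (M f) t - stieltjes n (cavity i (M f)) t)) + cmod (of_real s * H i i / of_nat n)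
        \<le> (2 / t\<^sup>2 + 1 / t) / sqrt n"
      by (simp add: add_divide_distrib mult.commute)
    then show "cmod (of_real s * (stieltjes n (M f) t - stieltjes n (cavity i (M f)) t) + of_real s * H i i / of_nat n)
        \<le> (2 / t\<^sup>2 + 1 / t) / sqrt n"
      by (rule order_trans [OF norm_triangle_ineq])
  qed (simp add: norm_divide)
  finally show ?thesis by (simp add: s_def H_def)
qed

text \<open>The semicircle law for the centred adjacency matrix, in quantitative form on the imaginary
  axis.\<close>

lemma wigner_semicircle_L1:
  assumes p: "0 < p" "p < 1" and t: "t > 0" and n: "n > 0"
  shows "measure_pmf.expectation (coins n p) (\<lambda>f.
      cmod (stieltjes n (scaled_wigner n p f) t - \<i> * of_real (semicircle_stieltjes (p * (1 - p)) t)))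
    \<le> (3 / t\<^sup>2 + 1 / t + 1 / 2) / t\<^sup>2 / sqrt n"
proof -
  let ?E = "measure_pmf.expectation (coins n p)"
  define s where "s = p * (1 - p)"
  have s: "s > 0" using p by (simp add: s_def)
  have p': "0 \<le> p" "p \<le> 1" using p by auto
  define m where "m f = stieltjes n (scaled_wigner n p f) t" for f
  define a where "a = (2 / t\<^sup>2 + 1 / t) / sqrt n"
  have pointwise: "cmod (m f - \<i> * of_real (semicircle_stieltjes s t))
      \<le> (\<Sum>i<n. a + cmod (cavity_fluctuation n p t i f) / n) / (n * t\<^sup>2)" for f
  proof -
    have "cmod (m f - \<i> * of_real (semicircle_stieltjes s t))
        \<le> cmod (of_real s * (m f)\<^sup>2 + \<i> * of_real t * m f + 1) / t"
      unfolding m_def by (intro semicircle_equation_stability s t stieltjes_Im_nonneg sym_on_scaled_wigner)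
    also have "\<dots> \<le> (\<Sum>i<n. cmod (of_real s * m f - (\<Sum>k<n. \<Sum>l<n.
        of_real (scaled_wigner n p f i k * scaled_wigner n p f i l)
         * resolvent n (cavity i (scaled_wigner n p f)) t k l))) / (n * t) / t"
      unfolding m_def using t
      by (intro divide_right_mono self_consistent_error sym_on_scaled_wigner n) (auto simp: scaled_wigner_def)
    also have "\<dots> \<le> (\<Sum>i<n. a + cmod (cavity_fluctuation n p t i f) / n) / (n * t) / t"
      unfolding m_def s_def a_def using t
      by (intro divide_right_mono sum_mono cavity_quadratic_form p' t) auto
    finally show ?thesis by (simp add: power2_eq_square mult.assoc)
  qed
  have "?E (\<lambda>f. cmod (m f - \<i> * of_real (semicircle_stieltjes s t)))
      \<le> ?E (\<lambda>f. (\<Sum>i<n. a + cmod (cavity_fluctuation n p t i f) / n) / (n * t\<^sup>2))"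
    by (intro expectation_mono_coins pointwise)
  also have "\<dots> = (\<Sum>i<n. a + ?E (\<lambda>f. cmod (cavity_fluctuation n p t i f)) / n) / (n * t\<^sup>2)"
    by (simp add: expectation_sum_coins Bochner_Integration.integral_add integrable_coins)
  also have "\<dots> \<le> (\<Sum>i<n. a + sqrt n * (1 / 2 + 1 / t\<^sup>2) / n) / (n * t\<^sup>2)"
    using t by (intro divide_right_mono sum_mono add_left_mono cavity_fluctuation_L1 p' t) auto
  also have "\<dots> = (a + sqrt n * (1 / 2 + 1 / t\<^sup>2) / n) / t\<^sup>2"
    using n by simp
  also have "sqrt n * (1 / 2 + 1 / t\<^sup>2) / n = (1 / 2 + 1 / t\<^sup>2) / sqrt n"
  proof -
    have "sqrt n / n = 1 / sqrt n" using n by (simp add: divide_simps)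
    then show ?thesis by (metis mult.commute times_divide_eq_left times_divide_eq_right mult_1)
  qed
  also have "(a + (1 / 2 + 1 / t\<^sup>2) / sqrt n) / t\<^sup>2 = (3 / t\<^sup>2 + 1 / t + 1 / 2) / t\<^sup>2 / sqrt n"
    by (simp add: a_def add_divide_distrib power2_eq_square power4_eq_xxxx mult_ac)
  finally show ?thesis by (simp add: m_def s_def)
qed

section \<open>Comparison of the augmented Zagreb matrix with a Wigner matrix\<close>

abbreviation graph_of :: "nat \<Rightarrow> (nat set \<Rightarrow> bool) \<Rightarrow> nat set set" where
  "graph_of n f \<equiv> {e \<in> vertex_pairs n. f e}"

lemma edge_graph_of_iff:
  assumes "k < n" "l < n"
  shows "{Suc k, Suc l} \<in> graph_of n f \<longleftrightarrow> k \<noteq> l \<and> f {Suc k, Suc l}"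
  using assms by (auto simp: vertex_pairs_def card_insert_if)

lemma vertex_degree_graph_of:
  assumes i: "i < n"
  shows "vertex_degree (graph_of n f) (Suc i) = card {k. k < n \<and> k \<noteq> i \<and> f {Suc i, Suc k}}"
proof -
  have "{e \<in> graph_of n f. Suc i \<in> e} = (\<lambda>k. {Suc i, Suc k}) ` {k. k < n \<and> k \<noteq> i \<and> f {Suc i, Suc k}}"
  proof (intro equalityI subsetI)
    fix e assume "e \<in> {e \<in> graph_of n f. Suc i \<in> e}"
    then have e: "e \<subseteq> {1..n}" "card e = 2" "f e" "Suc i \<in> e" by (auto simp: vertex_pairs_def)
    then obtain x y where "e = {x, y}" "x \<noteq> y" by (auto simp: card_2_iff)
    with e(4) obtain z where z: "e = {Suc i, z}" "z \<noteq> Suc i" by auto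
    with e(1) obtain k where "z = Suc k" "k < n" by (cases z) auto
    with z e(3) show "e \<in> (\<lambda>k. {Suc i, Suc k}) ` {k. k < n \<and> k \<noteq> i \<and> f {Suc i, Suc k}}" by auto
  next
    fix e assume "e \<in> (\<lambda>k. {Suc i, Suc k}) ` {k. k < n \<and> k \<noteq> i \<and> f {Suc i, Suc k}}"
    then show "e \<in> {e \<in> graph_of n f. Suc i \<in> e}"
      using edge_in_vertex_pairs [OF i] by auto
  qed
  moreover have "inj_on (\<lambda>k. {Suc i, Suc k}) {k. k < n \<and> k \<noteq> i \<and> f {Suc i, Suc k}}"
    by (auto simp: inj_on_def doubleton_eq_iff)
  ultimately show ?thesis by (simp add: vertex_degree_def card_image)
qed

definition degree_deviation :: "nat \<Rightarrow> real \<Rightarrow> (nat set \<Rightarrow> bool) \<Rightarrow> nat \<Rightarrow> real" where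
  "degree_deviation n p f i = vertex_degree (graph_of n f) (Suc i) / n - p"

lemma degree_deviation_eq:
  assumes i: "i < n"
  shows "degree_deviation n p f i = ((\<Sum>k<n. wigner p f i k) - p) / n"
proof -
  have "(\<Sum>k<n. wigner p f i k) - p = (\<Sum>k<n. of_bool (k \<noteq> i \<and> f {Suc i, Suc k}) - p + (if k = i then p else 0)) - p"
    by (intro arg_cong2 [where f = "(-)"] sum.cong refl) (auto simp: wigner_def)
  also have "\<dots> = (\<Sum>k<n. of_bool (k \<noteq> i \<and> f {Suc i, Suc k})) - n * p"
    using i by (simp add: sum.distrib sum_subtractf)
  also have "(\<Sum>k<n. of_bool (k \<noteq> i \<and> f {Suc i, Suc k})) = real (vertex_degree (graph_of n f) (Suc i))"
    unfolding vertex_degree_graph_of [OF i]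
    by (simp add: of_bool_def sum.If_cases Int_def)
  finally show ?thesis using i by (simp add: degree_deviation_def field_simps)
qed

text \<open>Each deviation has second moment of order \<open>1 / n\<close>, by the orthogonality of the entries of a
  row. A bound on the sum over all vertices replaces uniform concentration of the degrees.\<close>

lemma degree_deviation_variance:
  assumes p: "0 \<le> p" "p \<le> 1" and n: "n > 0"
  shows "measure_pmf.expectation (coins n p) (\<lambda>f. \<Sum>i<n. (degree_deviation n p f i)\<^sup>2) \<le> 4"
proof -
  let ?E = "measure_pmf.expectation (coins n p)"
  have "?E (\<lambda>f. \<Sum>i<n. (degree_deviation n p f i)\<^sup>2) = (\<Sum>i<n. ?E (\<lambda>f. (degree_deviation n p f i)\<^sup>2))"
    by (rule expectation_sum_coins)
  also have "\<dots> \<le> (\<Sum>i<n. 4 / n)"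
  proof (intro sum_mono)
    fix i assume "i \<in> {..<n}"
    then have i: "i < n" by simp
    have "(degree_deviation n p f i)\<^sup>2 \<le> (2 / n\<^sup>2) * ((\<Sum>k<n. wigner p f i k)\<^sup>2 + 1)" for f
    proof -
      define x where "x = (\<Sum>k<n. wigner p f i k)"
      have "(x - p)\<^sup>2 \<le> 2 * x\<^sup>2 + 2 * p\<^sup>2"
        using zero_le_power2 [of "x + p"] by (simp add: power2_eq_square algebra_simps)
      also have "\<dots> \<le> 2 * (x\<^sup>2 + 1)" using p by (simp add: abs_square_le_1)
      finally have "(x - p)\<^sup>2 / n\<^sup>2 \<le> 2 * (x\<^sup>2 + 1) / n\<^sup>2"
        by (intro divide_right_mono) auto
      then show ?thesis
        by (simp add: degree_deviation_eq [OF i] x_def power_divide)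
    qed
    then have "?E (\<lambda>f. (degree_deviation n p f i)\<^sup>2) \<le> ?E (\<lambda>f. (2 / n\<^sup>2) * ((\<Sum>k<n. wigner p f i k)\<^sup>2 + 1))"
      by (intro expectation_mono_coins)
    also have "\<dots> = (2 / n\<^sup>2) * (?E (\<lambda>f. (\<Sum>k<n. wigner p f i k)\<^sup>2) + 1)"
      by (simp add: Bochner_Integration.integral_add integrable_coins)
    also have "\<dots> \<le> (2 / n\<^sup>2) * (n + n)"
      using n row_sum_variance [OF p i] by (intro mult_left_mono add_mono) auto
    also have "\<dots> = 4 / n" using n by (simp add: field_simps power2_eq_square)
    finally show "?E (\<lambda>f. (degree_deviation n p f i)\<^sup>2) \<le> 4 / n" .
  qed
  also have "\<dots> = 4" using n by simp
  finally show ?thesis .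
qed

text \<open>The cube root of an entry at an edge joining vertices of degrees \<open>a\<close> and \<open>b\<close>; the value \<open>0\<close>
  at \<open>a = b = 1\<close> is the convention for isolated edges.\<close>

definition zagreb_ratio :: "nat \<Rightarrow> nat \<Rightarrow> real" where
  "zagreb_ratio a b = (if a = 1 \<and> b = 1 then 0 else real a * real b / (real a + real b - 2))"

lemma azi_entry_eq:
  "azi_entry E i j = (if {i, j} \<in> E then zagreb_ratio (vertex_degree E i) (vertex_degree E j) ^ 3 else 0)"
  by (simp add: azi_entry_def zagreb_ratio_def)

lemma zagreb_ratio_bounds:
  assumes "1 \<le> a" "a \<le> n" "1 \<le> b" "b \<le> n"
  shows "0 \<le> zagreb_ratio a b" "zagreb_ratio a b \<le> 2 * real n"
proof -
  have "0 \<le> zagreb_ratio a b \<and> zagreb_ratio a b \<le> 2 * real n"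
  proof (cases "a = 1 \<and> b = 1")
    case False
    then have D: "real a + real b - 2 > 0" using assms by (cases "a = 1") auto
    have "real a * real b \<le> 2 * real n * (real a + real b - 2)"
    proof (cases "2 \<le> b")
      case True
      have "real a * real b \<le> real n * real b" using assms by (intro mult_right_mono) auto
      also have "\<dots> \<le> real n * (2 * (real a + real b - 2))" using assms True by (intro mult_left_mono) auto
      finally show ?thesis by (simp add: algebra_simps)
    next
      case b: False
      then have "b = 1" "2 \<le> a" using False assms by auto
      have "real a \<le> real n * real a" using assms by simp
      also have "\<dots> \<le> real n * (2 * (real a + real b - 2))" using \<open>b = 1\<close> \<open>2 \<le> a\<close> by (intro mult_left_mono) auto
      finally show ?thesis using \<open>b = 1\<close> by (simp add: algebra_simps)
    qed
    then show ?thesis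
      using False D by (auto simp: zagreb_ratio_def pos_divide_le_eq)
  qed (simp add: zagreb_ratio_def)
  then show "0 \<le> zagreb_ratio a b" "zagreb_ratio a b \<le> 2 * real n" by auto
qed

text \<open>A Lipschitz bound around the typical degree that holds for all positive degrees. When \<open>D\<close>,
  the denominator of the ratio divided by \<open>n\<close>, is at least \<open>p / 2\<close>, the difference is computed
  directly. Otherwise, and also for an isolated edge, the right-hand side is at least \<open>9 / 2\<close>, and the
  crude bound of \<open>zagreb_ratio_bounds\<close> suffices.\<close>

lemma zagreb_ratio_deviation:
  fixes a b n :: nat
  assumes a: "1 \<le> a" "a \<le> n" and b: "1 \<le> b" "b \<le> n" and p: "0 < p" "p \<le> 1"
  shows "\<bar>zagreb_ratio a b / n - p / 2\<bar> \<le> 3 / p * (\<bar>a / n - p\<bar> + \<bar>b / n - p\<bar> + 2 / n)"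
proof -
  define x y u where "x = real a / n" and "y = real b / n" and "u = 2 / real n"
  define S where "S = \<bar>x - p\<bar> + \<bar>y - p\<bar> + u"
  have n: "n > 0" using a by simp
  have xy: "0 \<le> x" "x \<le> 1" "0 \<le> y" "y \<le> 1" "0 \<le> u"
    using a b n by (auto simp: x_def y_def u_def)
  have r: "0 \<le> zagreb_ratio a b / n" "zagreb_ratio a b / n \<le> 2"
    using zagreb_ratio_bounds [OF a b] n by (auto simp: field_simps)
  have far: ?thesis if "3 * p / 2 \<le> S"
  proof -
    have "\<bar>zagreb_ratio a b / n - p / 2\<bar> \<le> 9 / 2"
      unfolding abs_le_iff using r p by linarith
    also have "\<dots> = 3 / p * (3 * p / 2)" using p by simp
    also have "\<dots> \<le> 3 / p * S" using that p by (intro mult_left_mono) auto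
    finally show ?thesis by (simp add: S_def x_def y_def u_def)
  qed
  show ?thesis
  proof (cases "a = 1 \<and> b = 1")
    case True
    then have "x + y = u" by (simp add: x_def y_def u_def)
    then have "3 * p / 2 \<le> S" using p unfolding S_def by linarith
    then show ?thesis by (rule far)
  next
    case False
    define D where "D = x + y - u"
    define q where "q = real a + real b - 2"
    have q: "q > 0" using False a b by (cases "a = 1") (auto simp: q_def)
    have D: "D = q / n"
      by (simp add: D_def q_def x_def y_def u_def add_divide_distrib diff_divide_distrib)
    then have Dpos: "D > 0" using q n by simp
    have "zagreb_ratio a b = real a * real b / q"
      using False by (simp add: zagreb_ratio_def q_def)
    then have ratio: "zagreb_ratio a b / n = x * y / D"
      using n q unfolding D x_def y_def by (simp add: field_simps)
    show ?thesis
    proof (cases "p / 2 \<le> D")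
      case True
      have "\<bar>x * (y - p) + y * (x - p) + p * u\<bar> \<le> \<bar>x * (y - p)\<bar> + \<bar>y * (x - p)\<bar> + \<bar>p * u\<bar>"
        by linarith
      also have "\<dots> \<le> 1 * \<bar>y - p\<bar> + 1 * \<bar>x - p\<bar> + 1 * u"
        unfolding abs_mult using xy p by (intro add_mono mult_mono) auto
      finally have num: "\<bar>x * (y - p) + y * (x - p) + p * u\<bar> \<le> S" by (simp add: S_def)
      have "x * y / D - p / 2 = (x * (y - p) + y * (x - p) + p * u) / (2 * D)"
        using Dpos by (simp add: D_def field_simps)
      then have "\<bar>x * y / D - p / 2\<bar> = \<bar>x * (y - p) + y * (x - p) + p * u\<bar> / (2 * D)"
        using Dpos by (simp add: abs_divide)
      also have "\<dots> \<le> S / p"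
        using num True p by (intro frac_le) auto
      also have "\<dots> \<le> 3 / p * S"
        using p xy by (simp add: S_def divide_right_mono)
      finally show ?thesis unfolding ratio by (simp add: S_def x_def y_def u_def)
    next
      case False
      then have "3 * p / 2 \<le> S" unfolding D_def S_def by linarith
      then show ?thesis by (rule far)
    qed
  qed
qed

lemma cube_difference_bound:
  fixes r c :: real
  assumes "0 \<le> r" "r \<le> 2" "0 \<le> c" "c \<le> 1"
  shows "\<bar>r ^ 3 - c ^ 3\<bar> \<le> 7 * \<bar>r - c\<bar>"
proof -
  have "r * r \<le> 2 * 2" "r * c \<le> 2 * 1" "c * c \<le> 1 * 1"
    by (rule mult_mono; use assms in simp)+
  then have "r * r + r * c + c * c \<le> 7" by simp
  moreover have "0 \<le> r * r + r * c + c * c" using assms by simp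
  moreover have "r ^ 3 - c ^ 3 = (r * r + r * c + c * c) * (r - c)"
    by (simp add: power3_eq_cube algebra_simps)
  ultimately show ?thesis by (simp add: abs_mult mult_right_mono)
qed

text \<open>Typical entries at edges are \<open>(n p / 2)\<^sup>3\<close>, and \<open>sqrt n\<close> is the scale of the eigenvalues of a
  Wigner matrix.\<close>

definition azi_scale :: "nat \<Rightarrow> real \<Rightarrow> real" where
  "azi_scale n p = 1 / ((real n * p / 2) ^ 3 * sqrt n)"

definition azi_fun :: "nat \<Rightarrow> (nat set \<Rightarrow> bool) \<Rightarrow> nat \<Rightarrow> nat \<Rightarrow> real" where
  "azi_fun n f k l = azi_entry (graph_of n f) (Suc k) (Suc l)"

lemma sym_on_azi_fun: "sym_on n (azi_fun n f)"
  by (auto simp: sym_on_def azi_fun_def azi_entry_def insert_commute algebra_simps)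

lemma azi_matrix_graph_of: "azi_matrix n (graph_of n f) = Matrix.mat n n (\<lambda>(i,j). azi_fun n f i j)"
  by (simp add: azi_matrix_def azi_fun_def)

lemma azi_fun_no_edge:
  assumes "k < n" "l < n" "\<not> (k \<noteq> l \<and> f {Suc k, Suc l})"
  shows "azi_fun n f k l = 0"
  by (simp only: azi_fun_def azi_entry_eq edge_graph_of_iff [OF assms(1,2)] assms(3) if_False)

lemma scaled_azi_edge:
  assumes kl: "k < n" "l < n" "k \<noteq> l" "f {Suc k, Suc l}" and p: "0 < p"
  obtains a b where "a = vertex_degree (graph_of n f) (Suc k)" "b = vertex_degree (graph_of n f) (Suc l)"
    "1 \<le> a" "a \<le> n" "1 \<le> b" "b \<le> n"
    "azi_scale n p * azi_fun n f k l = (8 / p ^ 3) * (zagreb_ratio a b / n) ^ 3 / sqrt n"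
proof -
  define a b where "a = vertex_degree (graph_of n f) (Suc k)" and "b = vertex_degree (graph_of n f) (Suc l)"
  have fin: "finite {j. j < n \<and> j \<noteq> i \<and> f {Suc i, Suc j}}" for i by simp
  have "card {j. j < n \<and> j \<noteq> k \<and> f {Suc k, Suc j}} > 0" "card {j. j < n \<and> j \<noteq> l \<and> f {Suc l, Suc j}} > 0"
    using kl by (auto simp: card_gt_0_iff fin insert_commute)
  moreover have "card {j. j < n \<and> j \<noteq> i \<and> f {Suc i, Suc j}} \<le> n" for i
    using card_mono [of "{..<n}" "{j. j < n \<and> j \<noteq> i \<and> f {Suc i, Suc j}}"] by auto
  ultimately have "1 \<le> a" "a \<le> n" "1 \<le> b" "b \<le> n"
    using kl by (auto simp: a_def b_def vertex_degree_graph_of Suc_le_eq)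
  moreover have "azi_scale n p * azi_fun n f k l = (8 / p ^ 3) * (zagreb_ratio a b / n) ^ 3 / sqrt n"
    using edge_graph_of_iff [OF kl(1,2), of f] kl p
    by (simp add: azi_fun_def azi_entry_eq a_def b_def azi_scale_def power_divide power_mult_distrib)
  ultimately show thesis using that a_def b_def by blast
qed

lemma scaled_azi_frobenius:
  assumes p: "0 < p" and n: "n > 0"
  shows "(\<Sum>k<n. \<Sum>l<n. (azi_scale n p * azi_fun n f k l)\<^sup>2) / n \<le> (64 / p ^ 3)\<^sup>2"
proof -
  have entry: "(azi_scale n p * azi_fun n f k l)\<^sup>2 \<le> (64 / p ^ 3)\<^sup>2 / n" if kl: "k < n" "l < n" for k l
  proof (cases "k \<noteq> l \<and> f {Suc k, Suc l}")
    case True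
    obtain a b where ab: "1 \<le> a" "a \<le> n" "1 \<le> b" "b \<le> n"
      "azi_scale n p * azi_fun n f k l = (8 / p ^ 3) * (zagreb_ratio a b / n) ^ 3 / sqrt n"
      by (rule scaled_azi_edge [where f = f, OF kl(1) kl(2) True [THEN conjunct1] True [THEN conjunct2] p]) blast
    have "0 \<le> zagreb_ratio a b / n" "zagreb_ratio a b / n \<le> 2"
      using zagreb_ratio_bounds [OF ab(1-4)] n by (auto simp: field_simps)
    then have "((8 / p ^ 3) * (zagreb_ratio a b / n) ^ 3)\<^sup>2 \<le> ((8 / p ^ 3) * 2 ^ 3)\<^sup>2"
      using p by (intro power_mono mult_left_mono mult_nonneg_nonneg) auto
    then have "((8 / p ^ 3) * (zagreb_ratio a b / n) ^ 3)\<^sup>2 / n \<le> ((8 / p ^ 3) * 2 ^ 3)\<^sup>2 / n"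
      by (intro divide_right_mono) auto
    then show ?thesis unfolding ab(5) by (simp add: power_divide power_mult_distrib)
  next
    case False
    then show ?thesis by (simp add: azi_fun_no_edge [OF kl])
  qed
  have "(\<Sum>k<n. \<Sum>l<n. (azi_scale n p * azi_fun n f k l)\<^sup>2) \<le> (\<Sum>k<n. \<Sum>l<n. (64 / p ^ 3)\<^sup>2 / n)"
    by (intro sum_mono entry) auto
  also have "\<dots> = n * (64 / p ^ 3)\<^sup>2" using n by simp
  finally show ?thesis using n by (simp add: pos_divide_le_eq mult.commute)
qed

text \<open>What remains of the scaled matrix after removing the Wigner matrix and the constant matrix
  with entries \<open>p / sqrt n\<close>; on the diagonal this leaves \<open>- p / sqrt n\<close>.\<close>

definition azi_error :: "nat \<Rightarrow> real \<Rightarrow> (nat set \<Rightarrow> bool) \<Rightarrow> nat \<Rightarrow> nat \<Rightarrow> real" where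
  "azi_error n p f k l = azi_scale n p * azi_fun n f k l - scaled_wigner n p f k l - p / sqrt n"

lemma azi_error_entry:
  assumes p: "0 < p" "p \<le> 1" and kl: "k < n" "l < n"
  shows "(azi_error n p f k l)\<^sup>2 \<le> (if l = k then 1 / n else 0)
    + 3 * (168 / p ^ 4)\<^sup>2 / n * ((degree_deviation n p f k)\<^sup>2 + (degree_deviation n p f l)\<^sup>2 + (2 / n)\<^sup>2)"
    (is "_ \<le> ?d + ?r")
proof -
  have n: "n > 0" using kl by simp
  have r: "0 \<le> ?r" by simp
  have no_edge: "azi_fun n f k l = 0" if "\<not> (k \<noteq> l \<and> f {Suc k, Suc l})"
    using kl that by (rule azi_fun_no_edge)
  consider "k = l" | "k \<noteq> l" "\<not> f {Suc k, Suc l}" | "k \<noteq> l" "f {Suc k, Suc l}" by blast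
  then show ?thesis
  proof cases
    case 1
    then have "(azi_error n p f k l)\<^sup>2 = p\<^sup>2 / n"
      using no_edge by (simp add: azi_error_def scaled_wigner_def power_divide)
    also have "\<dots> \<le> 1 / n" using p by (intro divide_right_mono) (auto simp: abs_square_le_1)
    also have "\<dots> = ?d" using 1 by simp
    finally show ?thesis using r by linarith
  next
    case 2
    then have "azi_error n p f k l = 0"
      using no_edge by (simp add: azi_error_def scaled_wigner_def wigner_def)
    then show ?thesis using r by simp
  next
    case 3
    obtain a b where ab: "a = vertex_degree (graph_of n f) (Suc k)" "b = vertex_degree (graph_of n f) (Suc l)"
      "1 \<le> a" "a \<le> n" "1 \<le> b" "b \<le> n"
      "azi_scale n p * azi_fun n f k l = (8 / p ^ 3) * (zagreb_ratio a b / n) ^ 3 / sqrt n"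
      by (rule scaled_azi_edge [where f = f, OF kl(1) kl(2) 3(1) 3(2) p(1)])
    define R where "R = zagreb_ratio a b / n"
    define \<delta> where "\<delta> i = degree_deviation n p f i" for i
    have R: "0 \<le> R" "R \<le> 2"
      using zagreb_ratio_bounds [OF ab(3-6)] n by (auto simp: R_def field_simps)
    have dev: "\<bar>R - p / 2\<bar> \<le> 3 / p * (\<bar>\<delta> k\<bar> + \<bar>\<delta> l\<bar> + 2 / n)"
      using zagreb_ratio_deviation [OF ab(3-6) p] by (simp add: R_def \<delta>_def degree_deviation_def ab(1,2))
    \<comment> \<open>Here \<open>1 - p\<close> and \<open>p\<close> add up to the adjacency entry \<open>1\<close>, so the error is that of \<open>R\<^sup>3\<close> relative to \<open>(p / 2)\<^sup>3\<close>.\<close>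
    have "azi_error n p f k l = (8 / p ^ 3) * R ^ 3 / sqrt n - (1 - p) / sqrt n - p / sqrt n"
      using 3 by (simp add: azi_error_def ab(7) scaled_wigner_def wigner_def R_def)
    also have "\<dots> = (8 / p ^ 3) * (R ^ 3 - (p / 2) ^ 3) / sqrt n"
      using p n by (simp add: field_simps power_divide)
    finally have err: "\<bar>azi_error n p f k l\<bar> = (8 / p ^ 3) * \<bar>R ^ 3 - (p / 2) ^ 3\<bar> / sqrt n"
      using p by (simp only: abs_mult abs_divide) simp
    also have "\<dots> \<le> (8 / p ^ 3) * (7 * (3 / p * (\<bar>\<delta> k\<bar> + \<bar>\<delta> l\<bar> + 2 / n))) / sqrt n"
      using p R dev by (intro divide_right_mono mult_left_mono order_trans [OF cube_difference_bound]) auto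
    also have "\<dots> = (168 / p ^ 4) * (\<bar>\<delta> k\<bar> + \<bar>\<delta> l\<bar> + 2 / n) / sqrt n"
      using p by (simp add: eval_nat_numeral)
    finally have "\<bar>azi_error n p f k l\<bar>\<^sup>2 \<le> ((168 / p ^ 4) * (\<bar>\<delta> k\<bar> + \<bar>\<delta> l\<bar> + 2 / n) / sqrt n)\<^sup>2"
      by (intro power_mono) auto
    also have "\<dots> = (168 / p ^ 4)\<^sup>2 / n * (\<bar>\<delta> k\<bar> + \<bar>\<delta> l\<bar> + 2 / n)\<^sup>2"
    proof -
      have "(c * x / sqrt n)\<^sup>2 = c\<^sup>2 / n * x\<^sup>2" for c x :: real
        by (simp add: power_divide power_mult_distrib)
      then show ?thesis .
    qed
    also have "\<dots> \<le> (168 / p ^ 4)\<^sup>2 / n * (3 * ((\<delta> k)\<^sup>2 + (\<delta> l)\<^sup>2 + (2 / n)\<^sup>2))"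
    proof (intro mult_left_mono)
      have "(x + y + z)\<^sup>2 \<le> 3 * (x\<^sup>2 + y\<^sup>2 + z\<^sup>2)" for x y z :: real
        using zero_le_power2 [of "x - y"] zero_le_power2 [of "x - z"] zero_le_power2 [of "y - z"]
        by (simp add: power2_eq_square algebra_simps)
      from this [of "\<bar>\<delta> k\<bar>" "\<bar>\<delta> l\<bar>" "2 / n"]
      show "(\<bar>\<delta> k\<bar> + \<bar>\<delta> l\<bar> + 2 / n)\<^sup>2 \<le> 3 * ((\<delta> k)\<^sup>2 + (\<delta> l)\<^sup>2 + (2 / n)\<^sup>2)" by simp
    qed auto
    also have "\<dots> = ?r" by (simp add: \<delta>_def)
    also have "\<dots> \<le> ?d + ?r" by simp
    finally show ?thesis by simp
  qed
qed

text \<open>The expected squared Frobenius norm stays bounded, although it is a sum over \<open>n\<^sup>2\<close> entries: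
  up to terms of total size \<open>O(1)\<close>, each squared entry is at most a multiple of \<open>1 / n\<close> times the
  squared degree deviations, whose sum over all vertices has bounded expectation.\<close>

lemma azi_error_frobenius:
  assumes p: "0 < p" "p \<le> 1" and n: "n > 0"
  shows "measure_pmf.expectation (coins n p) (\<lambda>f. \<Sum>k<n. \<Sum>l<n. (azi_error n p f k l)\<^sup>2)
    \<le> 1 + 36 * (168 / p ^ 4)\<^sup>2"
proof -
  let ?E = "measure_pmf.expectation (coins n p)"
  define K where "K = (168 / p ^ 4)\<^sup>2"
  have K: "K \<ge> 0" by (simp add: K_def)
  have pointwise: "(\<Sum>k<n. \<Sum>l<n. (azi_error n p f k l)\<^sup>2)
      \<le> 1 + 12 * K + 6 * K * (\<Sum>k<n. (degree_deviation n p f k)\<^sup>2)" for f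
  proof -
    define T where "T = (\<Sum>k<n. (degree_deviation n p f k)\<^sup>2)"
    have "(\<Sum>k<n. \<Sum>l<n. (azi_error n p f k l)\<^sup>2) \<le> (\<Sum>k<n. \<Sum>l<n. (if l = k then 1 / n else 0)
      + 3 * K / n * ((degree_deviation n p f k)\<^sup>2 + (degree_deviation n p f l)\<^sup>2 + (2 / n)\<^sup>2))"
      unfolding K_def by (intro sum_mono azi_error_entry p) auto
    also have "\<dots> = 1 + 3 * K / n * (n * T + n * T + n * (n * (2 / n)\<^sup>2))"
    proof -
      have "(\<Sum>k<n. \<Sum>l<n. (if l = k then 1 / n else 0)
          + c * ((degree_deviation n p f k)\<^sup>2 + (degree_deviation n p f l)\<^sup>2 + u))
        = 1 + c * (n * T + n * T + n * (n * u))" for c u :: real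
        using n by (simp add: sum.distrib sum_distrib_left [symmetric] T_def)
      then show ?thesis .
    qed
    also have "\<dots> = 1 + 12 * K / n + 6 * K * T"
      using n by (simp add: field_simps power2_eq_square)
    also have "12 * K / n \<le> 12 * K / 1" using n K by (intro frac_le) auto
    finally show ?thesis by (simp add: T_def)
  qed
  have "?E (\<lambda>f. \<Sum>k<n. \<Sum>l<n. (azi_error n p f k l)\<^sup>2)
      \<le> ?E (\<lambda>f. 1 + 12 * K + 6 * K * (\<Sum>k<n. (degree_deviation n p f k)\<^sup>2))"
    by (intro expectation_mono_coins pointwise)
  also have "\<dots> = 1 + 12 * K + 6 * K * ?E (\<lambda>f. \<Sum>k<n. (degree_deviation n p f k)\<^sup>2)"
    by (simp add: Bochner_Integration.integral_add integrable_coins)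
  also have "\<dots> \<le> 1 + 12 * K + 6 * K * 4"
    using K degree_deviation_variance [of p n] p n by (intro add_left_mono mult_left_mono) auto
  finally show ?thesis by (simp add: K_def)
qed

abbreviation scaled_azi :: "nat \<Rightarrow> real \<Rightarrow> (nat set \<Rightarrow> bool) \<Rightarrow> nat \<Rightarrow> nat \<Rightarrow> real" where
  "scaled_azi n p f \<equiv> (\<lambda>k l. azi_scale n p * azi_fun n f k l)"

lemma sym_on_scaled_azi: "sym_on n (scaled_azi n p f)"
  using sym_on_azi_fun [of n f] by (simp add: sym_on_def)

text \<open>The constant part and the error part of the difference to the Wigner matrix change the
  Stieltjes transform by \<open>O(1 / sqrt n)\<close> each, by \<open>resolvent_trace_perturbation\<close>.\<close>

lemma azi_semicircle_L1:
  assumes p: "0 < p" "p < 1" and t: "t > 0" and n: "n > 0"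
  shows "measure_pmf.expectation (coins n p) (\<lambda>f.
      \<bar>Im (stieltjes n (scaled_azi n p f) t) - semicircle_stieltjes (p * (1 - p)) t\<bar>)
    \<le> ((3 / t\<^sup>2 + 1 / t + 1 / 2) / t\<^sup>2 + (2 + 18 * (168 / p ^ 4)\<^sup>2) / t\<^sup>2) / sqrt n"
proof -
  let ?E = "measure_pmf.expectation (coins n p)"
  define g where "g = semicircle_stieltjes (p * (1 - p)) t"
  define F where "F f = (\<Sum>k<n. \<Sum>l<n. (azi_error n p f k l)\<^sup>2)" for f
  define K where "K = (168 / p ^ 4)\<^sup>2"
  have sn: "sqrt n > 0" "sqrt n * sqrt n = n" using n by auto
  have sqrt_F: "sqrt (F f) \<le> (1 + F f) / 2" for f
  proof -
    have "F f \<ge> 0" by (simp add: F_def sum_nonneg)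
    then show ?thesis using arith_geo_mean_sqrt [of 1 "F f"] by simp
  qed
  have pert: "cmod (stieltjes n (scaled_wigner n p f) t - stieltjes n (scaled_azi n p f) t)
      \<le> (2 + F f) / (2 * t\<^sup>2) * (1 / sqrt n) + 1 / (2 * t\<^sup>2) * (1 / sqrt n)" for f
  proof -
    have "cmod ((\<Sum>i<n. resolvent n (scaled_wigner n p f) t i i) - (\<Sum>i<n. resolvent n (scaled_azi n p f) t i i))
        \<le> (\<bar>p / sqrt n\<bar> * n + sqrt n * sqrt (F f)) / t\<^sup>2"
      unfolding F_def
      by (rule resolvent_trace_perturbation [OF sym_on_scaled_wigner sym_on_scaled_azi t])
         (simp add: azi_error_def)
    also have "\<bar>p / sqrt n\<bar> * n = sqrt n * p"
      using p sn by (simp add: field_simps)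
    also have "(sqrt n * p + sqrt n * sqrt (F f)) / t\<^sup>2 \<le> (sqrt n * 1 + sqrt n * ((1 + F f) / 2)) / t\<^sup>2"
      using p sqrt_F by (intro divide_right_mono add_mono mult_left_mono) auto
    finally have "cmod ((\<Sum>i<n. resolvent n (scaled_wigner n p f) t i i) - (\<Sum>i<n. resolvent n (scaled_azi n p f) t i i)) / n
        \<le> (sqrt n * 1 + sqrt n * ((1 + F f) / 2)) / t\<^sup>2 / n"
      by (intro divide_right_mono) auto
    also have "\<dots> = (1 + (1 + F f) / 2) / t\<^sup>2 * (sqrt n / n)"
      by (simp add: algebra_simps add_divide_distrib)
    also have "sqrt n / n = 1 / sqrt n" using n by (simp add: divide_simps)
    also have "(1 + (1 + F f) / 2) / t\<^sup>2 * (1 / sqrt n) = (2 + F f) / (2 * t\<^sup>2) * (1 / sqrt n) + 1 / (2 * t\<^sup>2) * (1 / sqrt n)"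
      using t sn by (simp add: field_simps)
    finally show ?thesis by (simp add: stieltjes_def diff_divide_distrib [symmetric] norm_divide)
  qed
  have "\<bar>Im (stieltjes n (scaled_azi n p f) t) - g\<bar>
      \<le> cmod (stieltjes n (scaled_wigner n p f) t - \<i> * of_real g)
       + ((2 + F f) / (2 * t\<^sup>2) * (1 / sqrt n) + 1 / (2 * t\<^sup>2) * (1 / sqrt n))" for f
  proof -
    have "\<bar>Im (stieltjes n (scaled_azi n p f) t) - g\<bar> \<le> cmod (stieltjes n (scaled_azi n p f) t - \<i> * of_real g)"
      using abs_Im_le_cmod [of "stieltjes n (scaled_azi n p f) t - \<i> * of_real g"] by simp
    also have "\<dots> = cmod ((stieltjes n (scaled_wigner n p f) t - \<i> * of_real g)
        - (stieltjes n (scaled_wigner n p f) t - stieltjes n (scaled_azi n p f) t))" by simp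
    also have "\<dots> \<le> cmod (stieltjes n (scaled_wigner n p f) t - \<i> * of_real g)
        + cmod (stieltjes n (scaled_wigner n p f) t - stieltjes n (scaled_azi n p f) t)"
      by (rule norm_triangle_ineq4)
    finally show ?thesis using pert [of f] by linarith
  qed
  then have "?E (\<lambda>f. \<bar>Im (stieltjes n (scaled_azi n p f) t) - g\<bar>)
     \<le> ?E (\<lambda>f. cmod (stieltjes n (scaled_wigner n p f) t - \<i> * of_real g)
       + ((2 + F f) / (2 * t\<^sup>2) * (1 / sqrt n) + 1 / (2 * t\<^sup>2) * (1 / sqrt n)))"
    by (intro expectation_mono_coins)
  also have "\<dots> = ?E (\<lambda>f. cmod (stieltjes n (scaled_wigner n p f) t - \<i> * of_real g))
       + ((2 + ?E F) / (2 * t\<^sup>2) * (1 / sqrt n) + 1 / (2 * t\<^sup>2) * (1 / sqrt n))"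
    by (simp add: Bochner_Integration.integral_add integrable_coins)
  also have "\<dots> \<le> (3 / t\<^sup>2 + 1 / t + 1 / 2) / t\<^sup>2 / sqrt n
       + ((2 + (1 + 36 * K)) / (2 * t\<^sup>2) * (1 / sqrt n) + 1 / (2 * t\<^sup>2) * (1 / sqrt n))"
    using p t n azi_error_frobenius [of p n] unfolding g_def F_def K_def
    by (intro add_mono wigner_semicircle_L1 mult_right_mono divide_right_mono) auto
  also have "\<dots> = ((3 / t\<^sup>2 + 1 / t + 1 / 2) / t\<^sup>2 + (2 + 18 * K) / t\<^sup>2) / sqrt n"
  proof -
    have "(2 + (1 + 36 * K)) / (2 * t\<^sup>2) * (1 / sqrt n) + 1 / (2 * t\<^sup>2) * (1 / sqrt n) = (2 + 18 * K) / t\<^sup>2 / sqrt n"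
      using t sn by (simp add: field_simps)
    then show ?thesis by (simp add: add_divide_distrib)
  qed
  finally show ?thesis by (simp add: g_def K_def)
qed

section \<open>Convergence of the energy\<close>

abbreviation azi_energy :: "nat \<Rightarrow> real \<Rightarrow> (nat set \<Rightarrow> bool) \<Rightarrow> real" where
  "azi_energy n p f \<equiv> azi_scale n p * energy (azi_matrix n (graph_of n f)) / n"

definition coulson_gap :: "nat \<Rightarrow> real \<Rightarrow> (nat set \<Rightarrow> bool) \<Rightarrow> real \<Rightarrow> real" where
  "coulson_gap n p f t = indicator {0<..} t *
     (coulson n (scaled_azi n p f) t - p * (1 - p) * (semicircle_stieltjes (p * (1 - p)) t)\<^sup>2)"

text \<open>Both terms of the gap are integrands of Coulson type, so the integral of the gap is the
  deviation of the normalised energy from its limit.\<close>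

lemma coulson_gap_integral:
  assumes p: "0 < p" "p < 1" and n: "n > 0"
  shows "has_bochner_integral lborel (coulson_gap n p f)
    (pi / 2 * azi_energy n p f - 4 / 3 * sqrt (p * (1 - p)))"
proof -
  have "azi_scale n p > 0" using p n by (simp add: azi_scale_def)
  from coulson_integral [OF sym_on_azi_fun n this, of f]
  have 1: "has_bochner_integral lborel (\<lambda>t. indicator {0<..} t * coulson n (scaled_azi n p f) t)
      (pi / 2 * azi_energy n p f)"
    by (simp add: azi_matrix_graph_of)
  have "p * (1 - p) > 0" using p by simp
  from has_bochner_integral_diff [OF 1 semicircle_integral [OF this]]
  show ?thesis unfolding coulson_gap_def [abs_def] right_diff_distrib .
qed

lemma coulson_gap_bound:
  assumes p: "0 < p" "p < 1" and n: "n > 0"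
  shows "\<bar>coulson_gap n p f t\<bar> \<le> indicator {0<..} t * ((3 + (64 / p ^ 3)\<^sup>2) / (1 + t\<^sup>2))"
proof (cases "t > 0")
  case True
  define s g where "s = p * (1 - p)" and "g = semicircle_stieltjes s t"
  have s: "0 < s" "s \<le> 1" using p by (auto simp: s_def intro: mult_le_one)
  have g: "g > 0" "s * g\<^sup>2 + t * g = 1"
    using semicircle_stieltjes_pos [OF s(1)] semicircle_stieltjes_eq [OF s(1)] by (auto simp: g_def)
  have T: "1 + t\<^sup>2 > 0" by (intro add_pos_nonneg) auto
  have "s * g\<^sup>2 \<le> 2 / (1 + t\<^sup>2)"
  proof -
    have nn: "0 \<le> s * g\<^sup>2" "0 \<le> t * g" using s g True by auto
    then have tg: "t * g \<le> 1" and sg: "s * g\<^sup>2 \<le> 1" using g(2) by linarith+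
    have "s * (t * g)\<^sup>2 \<le> 1 * 1"
      using s nn tg by (intro mult_mono) (auto simp: abs_square_le_1)
    then have "s * g\<^sup>2 * (1 + t\<^sup>2) \<le> 2" using sg by (simp add: power_mult_distrib algebra_simps)
    then show ?thesis using T by (simp add: pos_le_divide_eq)
  qed
  moreover have "coulson n (scaled_azi n p f) t \<le> (1 + (64 / p ^ 3)\<^sup>2) / (1 + t\<^sup>2)"
  proof -
    have "coulson n (scaled_azi n p f) t
        \<le> (1 + (\<Sum>k<n. \<Sum>l<n. (scaled_azi n p f k l)\<^sup>2) / n) / (1 + t\<^sup>2)"
      by (rule coulson_bounds [OF sym_on_scaled_azi n True])
    also have "\<dots> \<le> (1 + (64 / p ^ 3)\<^sup>2) / (1 + t\<^sup>2)"
      using T scaled_azi_frobenius [OF p(1) n, of f] by (intro divide_right_mono add_left_mono) auto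
    finally show ?thesis .
  qed
  moreover have "0 \<le> coulson n (scaled_azi n p f) t"
    by (rule coulson_bounds [OF sym_on_scaled_azi n True])
  moreover have "0 \<le> s * g\<^sup>2" using s by simp
  ultimately have "\<bar>coulson n (scaled_azi n p f) t - s * g\<^sup>2\<bar>
      \<le> (1 + (64 / p ^ 3)\<^sup>2) / (1 + t\<^sup>2) + 2 / (1 + t\<^sup>2)" by linarith
  then show ?thesis
    using True by (simp add: coulson_gap_def s_def g_def add_divide_distrib [symmetric])
qed (simp add: coulson_gap_def)

lemma expected_coulson_gap_tendsto:
  assumes p: "0 < p" "p < 1"
  shows "(\<lambda>n. measure_pmf.expectation (coins (Suc n) p) (\<lambda>f. \<bar>coulson_gap (Suc n) p f t\<bar>)) \<longlonglongrightarrow> 0"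
proof (cases "t > 0")
  case t: True
  let ?E = "\<lambda>n. measure_pmf.expectation (coins n p)"
  define s g where "s = p * (1 - p)" and "g = semicircle_stieltjes s t"
  have "s * g\<^sup>2 + t * g = 1"
    using p semicircle_stieltjes_eq [of s] by (simp add: s_def g_def)
  then have gap: "\<bar>coulson_gap n p f t\<bar> = t * \<bar>Im (stieltjes n (scaled_azi n p f) t) - g\<bar>" for n f
  proof -
    have "coulson_gap n p f t = - (t * (Im (stieltjes n (scaled_azi n p f) t) - g))"
      using t \<open>s * g\<^sup>2 + t * g = 1\<close> by (simp add: coulson_gap_def coulson_def s_def g_def algebra_simps)
    then show ?thesis using t by (simp add: abs_mult)
  qed
  define C where "C = t * ((3 / t\<^sup>2 + 1 / t + 1 / 2) / t\<^sup>2 + (2 + 18 * (168 / p ^ 4)\<^sup>2) / t\<^sup>2)"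
  show ?thesis
  proof (rule tendsto_sandwich [OF always_eventually always_eventually tendsto_const])
    show "\<forall>n. 0 \<le> ?E (Suc n) (\<lambda>f. \<bar>coulson_gap (Suc n) p f t\<bar>)" by simp
    show "\<forall>n. ?E (Suc n) (\<lambda>f. \<bar>coulson_gap (Suc n) p f t\<bar>) \<le> C / sqrt (Suc n)"
    proof
      fix n
      have "?E (Suc n) (\<lambda>f. \<bar>coulson_gap (Suc n) p f t\<bar>)
          = t * ?E (Suc n) (\<lambda>f. \<bar>Im (stieltjes (Suc n) (scaled_azi (Suc n) p f) t) - g\<bar>)"
        by (simp add: gap)
      also have "\<dots> \<le> t * (((3 / t\<^sup>2 + 1 / t + 1 / 2) / t\<^sup>2 + (2 + 18 * (168 / p ^ 4)\<^sup>2) / t\<^sup>2) / sqrt (Suc n))"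
        unfolding g_def s_def using t by (intro mult_left_mono azi_semicircle_L1 p) auto
      finally show "?E (Suc n) (\<lambda>f. \<bar>coulson_gap (Suc n) p f t\<bar>) \<le> C / sqrt (Suc n)"
        by (simp add: C_def)
    qed
    have "(\<lambda>n. C / sqrt (real n)) \<longlonglongrightarrow> 0"
      by (intro tendsto_divide_0 [OF tendsto_const] filterlim_at_top_imp_at_infinity
          filterlim_compose [OF sqrt_at_top filterlim_real_sequentially])
    then show "(\<lambda>n. C / sqrt (Suc n)) \<longlonglongrightarrow> 0"
      by (rule LIMSEQ_Suc)
  qed
qed (simp add: coulson_gap_def)

text \<open>Dominated convergence in \<open>t\<close> for the expected absolute gap. The coin space is finite, so
  the expectation is a finite sum and commutes with the integral.\<close>

lemma azi_energy_L1:
  assumes p: "0 < p" "p < 1"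
  shows "(\<lambda>n. measure_pmf.expectation (coins n p)
     (\<lambda>f. \<bar>pi / 2 * azi_energy n p f - 4 / 3 * sqrt (p * (1 - p))\<bar>)) \<longlonglongrightarrow> 0"
proof (rule LIMSEQ_imp_Suc)
  \<comment> \<open>The bounds hold for positive n only, hence the shift of the sequence.\<close>
  let ?E = "\<lambda>n. measure_pmf.expectation (coins n p)"
  let ?\<phi> = "\<lambda>n t. ?E n (\<lambda>f. \<bar>coulson_gap n p f t\<bar>)"
  have E_sum: "?E n X = (\<Sum>f\<in>set_pmf (coins n p). X f * pmf (coins n p) f)" for n and X :: "_ \<Rightarrow> real"
    by (rule integral_measure_pmf_real) (auto simp: finite_set_coins)
  have gap_int: "integrable lborel (coulson_gap (Suc n) p f)" for n f
    using coulson_gap_integral [OF p zero_less_Suc] by (rule integrable.intros)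
  define w where "w t = indicator {0<..} t * ((3 + (64 / p ^ 3)\<^sup>2) / (1 + t\<^sup>2))" for t :: real
  have w: "integrable lborel w"
  proof -
    have "integrable lborel (\<lambda>t::real. indicator {0<..} t * (1\<^sup>2 / (1\<^sup>2 + t\<^sup>2)))"
      using coulson_integral_abs [of 1] by (rule integrable.intros)
    then have "integrable lborel (\<lambda>t. (3 + (64 / p ^ 3)\<^sup>2) * (indicator {0<..} t * (1\<^sup>2 / (1\<^sup>2 + t\<^sup>2))))"
      by (rule integrable_mult_right)
    then show ?thesis by (simp add: w_def [abs_def] mult_ac)
  qed
  have meas: "?\<phi> (Suc n) \<in> borel_measurable lborel" for n
    unfolding E_sum using borel_measurable_integrable [OF gap_int] by measurable
  have bound: "AE t in lborel. norm (?\<phi> (Suc n) t) \<le> w t" for n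
  proof (rule AE_I2)
    fix t
    have "?\<phi> (Suc n) t \<le> ?E (Suc n) (\<lambda>_. w t)"
      unfolding w_def by (intro expectation_mono_coins coulson_gap_bound p) simp
    then show "norm (?\<phi> (Suc n) t) \<le> w t" by simp
  qed
  have "(\<lambda>n. integral\<^sup>L lborel (?\<phi> (Suc n))) \<longlonglongrightarrow> integral\<^sup>L lborel (\<lambda>_ :: real. 0 :: real)"
    by (rule integral_dominated_convergence [where s = "\<lambda>n. ?\<phi> (Suc n)" and w = w])
       (use meas w bound in \<open>auto intro!: AE_I2 expected_coulson_gap_tendsto p\<close>)
  then have lim: "(\<lambda>n. integral\<^sup>L lborel (?\<phi> (Suc n))) \<longlonglongrightarrow> 0" by simp
  have le: "?E (Suc n) (\<lambda>f. \<bar>pi / 2 * azi_energy (Suc n) p f - 4 / 3 * sqrt (p * (1 - p))\<bar>)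
      \<le> integral\<^sup>L lborel (?\<phi> (Suc n))" for n
  proof -
    have "\<bar>pi / 2 * azi_energy (Suc n) p f - 4 / 3 * sqrt (p * (1 - p))\<bar>
        \<le> integral\<^sup>L lborel (\<lambda>t. \<bar>coulson_gap (Suc n) p f t\<bar>)" for f
      using integral_abs_bound [of lborel "coulson_gap (Suc n) p f"]
        has_bochner_integral_integral_eq [OF coulson_gap_integral [OF p zero_less_Suc, of n f]] by simp
    then have "?E (Suc n) (\<lambda>f. \<bar>pi / 2 * azi_energy (Suc n) p f - 4 / 3 * sqrt (p * (1 - p))\<bar>)
        \<le> ?E (Suc n) (\<lambda>f. integral\<^sup>L lborel (\<lambda>t. \<bar>coulson_gap (Suc n) p f t\<bar>))"
      by (intro expectation_mono_coins)
    also have "\<dots> = integral\<^sup>L lborel (?\<phi> (Suc n))"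
      unfolding E_sum using gap_int
      by (subst Bochner_Integration.integral_sum) (auto intro!: integrable_mult_left integrable_abs)
    finally show ?thesis .
  qed
  show "(\<lambda>n. ?E (Suc n) (\<lambda>f. \<bar>pi / 2 * azi_energy (Suc n) p f - 4 / 3 * sqrt (p * (1 - p))\<bar>)) \<longlonglongrightarrow> 0"
    by (rule tendsto_sandwich [OF always_eventually always_eventually tendsto_const lim]) (use le in auto)
qed

lemma energy_ratio_eq:
  assumes p: "0 < p" "p < 1" and n: "n > 0"
  shows "energy (azi_matrix n (graph_of n f)) / (p ^ 3 * sqrt (p * (1 - p)) / (3 * pi) * real n powr (9 / 2)) - 1
    = (pi / 2 * azi_energy n p f - 4 / 3 * sqrt (p * (1 - p))) / (4 / 3 * sqrt (p * (1 - p)))"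
proof -
  define r where "r = sqrt (p * (1 - p))"
  define q where "q = sqrt (real n)"
  have r: "r > 0" and q: "q > 0" using p n by (auto simp: r_def q_def)
  have "real n powr (9 / 2) = real n powr real 4 * real n powr (1 / 2)"
    using powr_add [of "real n" "real 4" "1 / 2"] by simp
  also have "\<dots> = real n ^ 4 * q"
    using n by (simp only: powr_realpow of_nat_0_less_iff) (simp add: powr_half_sqrt q_def)
  finally have pw: "real n powr (9 / 2) = real n ^ 4 * q" .
  show ?thesis
    unfolding pw azi_scale_def r_def [symmetric] q_def [symmetric]
    using p n r q by (simp add: field_simps eval_nat_numeral)
qed

theorem corollary9:
  fixes p :: real
  assumes "0 < p" and "p < 1"
  shows "\<forall>\<epsilon>>0. (\<lambda>n. measure_pmf.prob (gnp n p)
           {E. \<bar>energy (azi_matrix n E)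
                  / (p ^ 3 * sqrt (p * (1 - p)) / (3 * pi) * real n powr (9 / 2)) - 1\<bar> > \<epsilon>})
         \<longlonglongrightarrow> 0"
proof (intro allI impI)
  fix \<epsilon> :: real assume \<epsilon>: "\<epsilon> > 0"
  define L where "L = 4 / 3 * sqrt (p * (1 - p))"
  define Z where "Z n f = \<bar>pi / 2 * azi_energy n p f - L\<bar>" for n f
  define r where "r n E = energy (azi_matrix n E)
      / (p ^ 3 * sqrt (p * (1 - p)) / (3 * pi) * real n powr (9 / 2)) - 1" for n E
  have L: "L > 0" using assms by (simp add: L_def)
  \<comment> \<open>Markov's inequality for the normalised deviation \<open>Z\<close>.\<close>
  have markov: "measure_pmf.prob (gnp n p) {E. \<bar>r n E\<bar> > \<epsilon>}
      \<le> measure_pmf.expectation (coins n p) (Z n) / (L * \<epsilon>)" if n: "n > 0" for n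
  proof -
    have "indicator {f. \<bar>r n (graph_of n f)\<bar> > \<epsilon>} f \<le> Z n f / (L * \<epsilon>)" for f
    proof (cases "\<bar>r n (graph_of n f)\<bar> > \<epsilon>")
      case True
      have "\<bar>r n (graph_of n f)\<bar> = Z n f / L"
        unfolding r_def energy_ratio_eq [OF assms n] L_def [symmetric] Z_def abs_divide using L by simp
      with True L have "L * \<epsilon> \<le> Z n f" by (simp add: field_simps)
      with \<epsilon> L have "1 \<le> Z n f / (L * \<epsilon>)" by (simp only: pos_le_divide_eq mult_pos_pos mult_1)
      then show ?thesis using True by simp
    next
      case False
      then show ?thesis using \<epsilon> L by (simp add: Z_def)
    qed
    then have "measure_pmf.expectation (coins n p) (indicator {f. \<bar>r n (graph_of n f)\<bar> > \<epsilon>})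
        \<le> measure_pmf.expectation (coins n p) (\<lambda>f. Z n f / (L * \<epsilon>))"
      by (intro expectation_mono_coins)
    then show ?thesis
      by (simp add: gnp_def vimage_def)
  qed
  have "(\<lambda>n. measure_pmf.expectation (coins n p) (Z n) / (L * \<epsilon>)) \<longlonglongrightarrow> 0 / (L * \<epsilon>)"
    unfolding Z_def L_def using azi_energy_L1 [OF assms] \<epsilon> assms by (intro tendsto_divide tendsto_const) auto
  then have lim: "(\<lambda>n. measure_pmf.expectation (coins n p) (Z n) / (L * \<epsilon>)) \<longlonglongrightarrow> 0" by simp
  have "(\<lambda>n. measure_pmf.prob (gnp n p) {E. \<bar>r n E\<bar> > \<epsilon>}) \<longlonglongrightarrow> 0"
    by (rule tendsto_sandwich [OF _ _ tendsto_const lim])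
       (auto intro: always_eventually eventually_mono [OF eventually_gt_at_top [of 0]] markov)
  then show "(\<lambda>n. measure_pmf.prob (gnp n p)
           {E. \<bar>energy (azi_matrix n E)
                  / (p ^ 3 * sqrt (p * (1 - p)) / (3 * pi) * real n powr (9 / 2)) - 1\<bar> > \<epsilon>})
         \<longlonglongrightarrow> 0"
    by (simp only: r_def)
qed

end
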